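(* Let $0\le k<n$ be integers, let $1\le p<\infty$ and let $\varepsilon>0$. There exist positive constants $C'(n,k,\varepsilon)$ (depending only on $n,k,\varepsilon$) and $C(n,k)$ (depending only on $n,k$) such that \[ C'(n,k,\varepsilon)\cdot \delta^{\frac{k-n}{2np}+\varepsilon}\ \le\ \|M^k_\delta\|_{L^p\to L^p}\ \le\ C(n,k)\cdot \delta^{\frac{k-n}{2np}} \] for all $\delta\in(0,1)$.
   Context: For $x\in\mathbb{R}^n$ and $r>0$, let $S_k(x,r)$ denote the $k$-skeleton of the axes-parallel $n$-cube $x+[-r,r]^n$ (center $x$, side length $2r$), that is, $S_k(x,r)=x+\bigcup_{I}\prod_{i=1}^n A_{I,i}$, where $I$ ranges over the $k$-element subsets of $\{1,\dots,n\}$, $A_{I,i}=[-r,r]$ if $i\in I$ and $A_{I,i}=\{-r,r\}$ otherwise. It is the union of its $N=\binom{n}{k}2^{n-k}$ $k$-faces, enumerated $S_k^j(x,r)$, $j=1,\dots,N$; each $k$-face is obtained by choosing a $k$-element set $I$, letting the coordinates indexed by $I$ range over $[-r,r]$, fixing each remaining coordinate to be $r$ or $-r$, and translating by $x$. For $\delta>0$, $S^j_{k,\delta}(x,r)$ denotes the open $\delta$-neighborhood of $S_k^j(x,r)$, where neighborhoods are taken with respect to the distance induced by the infinity norm on $\mathbb{R}^n$. $\mathcal{L}_n$ is $n$-dimensional Lebesgue measure. For $f\in L^1_{\rm loc}(\mathbb{R}^n)$ the $k$-skeleton maximal operator with width $\delta$ is \[ M^k_\delta f(x)=\sup_{1\le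 r\le 2}\ \min_{1\le j\le N}\ \frac{1}{\mathcal{L}_n(S^j_{k,\delta}(x,r))}\int_{S^j_{k,\delta}(x,r)}|f(y)|\,dy , \] and $\|M^k_\delta\|_{L^p\to L^p}=\sup_{0\ne f\in L^p(\mathbb{R}^n)}\frac{\|M^k_\delta f\|_{L^p(\mathbb{R}^n)}}{\|f\|_{L^p(\mathbb{R}^n)}}$. (The operator is not sublinear; this supremum is the definition of the norm.) *)

theory Defs
  imports "HOL-Analysis.Analysis"
begin

text \<open>
  The face of the cube \<open>x + [-r,r]^n\<close> in which the coordinates in \<open>I\<close> vary, those in \<open>P\<close> are
  fixed at the upper end, and the remaining ones are fixed at the lower end.
\<close>
definition cube_face :: "real^'n \<Rightarrow> real \<Rightarrow> 'n set \<Rightarrow> 'n set \<Rightarrow> (real^'n) set" where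
  "cube_face x r I P = {x + u | u. \<forall>i.
     if i \<in> I then - r \<le> u $ i \<and> u $ i \<le> r else u $ i = (if i \<in> P then r else - r)}"

definition k_faces :: "nat \<Rightarrow> real^'n \<Rightarrow> real \<Rightarrow> (real^'n) set set" where
  "k_faces k x r = {cube_face x r I P | I P. card I = k \<and> P \<subseteq> - I}"

definition k_skeleton :: "nat \<Rightarrow> real^'n \<Rightarrow> real \<Rightarrow> (real^'n) set" where
  "k_skeleton k x r = (+) x ` (\<Union>I\<in>{I. card I = k}.
     {u. \<forall>i. u $ i \<in> (if i \<in> I then {-r..r} else {-r, r})})"

definition inf_nbhd :: "real \<Rightarrow> 'a::euclidean_space set \<Rightarrow> 'a set" where
  "inf_nbhd \<delta> S = {y. \<exists>z\<in>S. infnorm (y - z) < \<delta>}"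

text \<open>
  Averages, the maximal function and norms take values in \<open>[0,\<infinity>]\<close>, so that no supremum or
  integral is silently replaced by a default value.
\<close>
definition abs_average :: "'a::euclidean_space set \<Rightarrow> ('a \<Rightarrow> real) \<Rightarrow> ennreal" where
  "abs_average S f = (\<integral>\<^sup>+y\<in>S. ennreal \<bar>f y\<bar> \<partial>lebesgue) / emeasure lebesgue S"

definition skeleton_maximal ::
  "nat \<Rightarrow> real \<Rightarrow> (real^'n \<Rightarrow> real) \<Rightarrow> (real^'n \<Rightarrow> ennreal)" where
  "skeleton_maximal k \<delta> f x =
     (SUP r\<in>{1..2}. Min ((\<lambda>F. abs_average (inf_nbhd \<delta> F) f) ` k_faces k x r))"

text \<open>The power function on \<open>[0,\<infinity>]\<close>, meant for exponents \<open>a > 0\<close> only.\<close>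
definition ennreal_powr :: "ennreal \<Rightarrow> real \<Rightarrow> ennreal" where
  "ennreal_powr t a = (if t = \<infinity> then \<infinity> else ennreal (enn2real t powr a))"

definition Lp_norm :: "real \<Rightarrow> ('a::euclidean_space \<Rightarrow> ennreal) \<Rightarrow> ennreal" where
  "Lp_norm p g = ennreal_powr (\<integral>\<^sup>+x. ennreal_powr (g x) p \<partial>lebesgue) (1 / p)"

abbreviation Lp_norm_real :: "real \<Rightarrow> ('a::euclidean_space \<Rightarrow> real) \<Rightarrow> ennreal" where
  "Lp_norm_real p f \<equiv> Lp_norm p (\<lambda>x. ennreal \<bar>f x\<bar>)"

definition Lp_space :: "real \<Rightarrow> ('a::euclidean_space \<Rightarrow> real) set" where
  "Lp_space p = {f \<in> borel_measurable lebesgue. Lp_norm_real p f < \<infinity>}"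

text \<open>
  Elements of \<open>L^p\<close> are represented by functions, so \<open>f \<noteq> 0\<close> means that \<open>f\<close> does not vanish
  almost everywhere.
\<close>
definition Lp_opnorm ::
  "real \<Rightarrow> (('a::euclidean_space \<Rightarrow> real) \<Rightarrow> ('a \<Rightarrow> ennreal)) \<Rightarrow> ennreal" where
  "Lp_opnorm p T = (SUP f\<in>{f \<in> Lp_space p. \<not> (AE x in lebesgue. f x = 0)}.
     Lp_norm p (T f) / Lp_norm_real p f)"

lemma k_faces_eq_image:
  "k_faces k x r = (\<lambda>(I, P). cube_face x r I P) ` (SIGMA I:{I. card I = k}. Pow (- I))"
  by (auto simp: k_faces_def image_def)

lemma finite_k_faces: "finite (k_faces k x r)"
  unfolding k_faces_eq_image by (rule finite_imageI) simp

lemma k_faces_nonempty: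
  fixes x :: "real^'n"
  assumes "k \<le> CARD('n)"
  shows "k_faces k x r \<noteq> {}"
proof -
  obtain I :: "'n set" where "card I = k"
    using obtain_subset_with_card_n[OF assms] by metis
  then show ?thesis by (auto simp: k_faces_def)
qed

lemma Union_k_faces: "\<Union> (k_faces k x r) = k_skeleton k x r"
proof
  show "\<Union> (k_faces k x r) \<subseteq> k_skeleton k x r"
  proof
    fix y assume "y \<in> \<Union> (k_faces k x r)"
    then obtain I P u where I: "card I = k" and y: "y = x + u"
      and u: "\<forall>i. if i \<in> I then - r \<le> u $ i \<and> u $ i \<le> r else u $ i = (if i \<in> P then r else - r)"
      by (auto simp: k_faces_def cube_face_def)
    have "\<forall>i. u $ i \<in> (if i \<in> I then {-r..r} else {-r, r})"
      using u by (metis atLeastAtMost_iff insert_iff)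
    with I y show "y \<in> k_skeleton k x r" unfolding k_skeleton_def by blast
  qed
  show "k_skeleton k x r \<subseteq> \<Union> (k_faces k x r)"
  proof
    fix y assume "y \<in> k_skeleton k x r"
    then obtain I u where I: "card I = k" and y: "y = x + u"
      and u: "\<forall>i. u $ i \<in> (if i \<in> I then {-r..r} else {-r, r})"
      by (auto simp: k_skeleton_def)
    have "if i \<in> I then - r \<le> u $ i \<and> u $ i \<le> r
        else u $ i = (if i \<in> {i \<in> - I. u $ i = r} then r else - r)" for i
      using u[rule_format, of i] by (auto split: if_splits)
    then have "y \<in> cube_face x r I {i \<in> - I. u $ i = r}"
      using y unfolding cube_face_def by blast
    moreover have "cube_face x r I {i \<in> - I. u $ i = r} \<in> k_faces k x r"
      unfolding k_faces_def using I by blast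
    ultimately show "y \<in> \<Union> (k_faces k x r)" by blast
  qed
qed

lemma cube_face_subset_imp:
  fixes x :: "real^'n"
  assumes "r > 0" "cube_face x r I P \<subseteq> cube_face x r J Q"
  shows "I \<subseteq> J" "- J \<inter> P = - J \<inter> Q"
proof -
  define u :: "real^'n" where "u = (\<chi> i. if i \<in> I then 0 else if i \<in> P then r else - r)"
  have "x + u \<in> cube_face x r I P"
    using assms(1) by (auto simp: cube_face_def u_def)
  then have "x + u \<in> cube_face x r J Q" using assms(2) by blast
  then have *: "if i \<in> J then - r \<le> u $ i \<and> u $ i \<le> r else u $ i = (if i \<in> Q then r else - r)" for i
    by (auto simp: cube_face_def)
  show "I \<subseteq> J"
  proof
    fix i assume "i \<in> I"
    then show "i \<in> J" using *[of i] assms(1) by (auto simp: u_def split: if_splits)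
  qed
  have "i \<in> P \<longleftrightarrow> i \<in> Q" if "i \<notin> J" for i
    using *[of i] that assms(1) \<open>I \<subseteq> J\<close> by (auto simp: u_def split: if_splits)
  then show "- J \<inter> P = - J \<inter> Q" by blast
qed

lemma card_k_faces:
  fixes x :: "real^'n"
  assumes "r > 0"
  shows "card (k_faces k x r) = (CARD('n) choose k) * 2 ^ (CARD('n) - k)"
proof -
  have inj: "inj_on (\<lambda>(I, P). cube_face x r I P) (SIGMA I:{I. card I = k}. Pow (- I))"
  proof (rule inj_onI, clarsimp)
    fix I J P Q :: "'n set"
    assume P: "P \<subseteq> - I" and Q: "Q \<subseteq> - J" and eq: "cube_face x r I P = cube_face x r J Q"
    have "I = J"
      using cube_face_subset_imp(1)[OF assms] eq by (metis subset_antisym subset_refl)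
    moreover have "- J \<inter> P = - J \<inter> Q"
      using cube_face_subset_imp(2)[OF assms] eq by blast
    ultimately show "I = J \<and> P = Q" using P Q by blast
  qed
  have "card (k_faces k x r) = card (SIGMA I:{I :: 'n set. card I = k}. Pow (- I))"
    unfolding k_faces_eq_image by (rule card_image[OF inj])
  also have "\<dots> = (\<Sum>I\<in>{I :: 'n set. card I = k}. 2 ^ (CARD('n) - k))"
    by (simp add: card_Pow Compl_eq_Diff_UNIV card_Diff_subset)
  also have "\<dots> = (CARD('n) choose k) * 2 ^ (CARD('n) - k)"
    using n_subsets[of "UNIV :: 'n set" k] by simp
  finally show ?thesis .
qed

end

(*
  Put m = n - k. Upper bound: with N about 1 / delta, replace averages over neighbourhoods of faces
  by averages over cells of a grid of mesh 1 / N. Since (average of |f|)^p is at most 2^p times the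
  average of |f|^p, it suffices to bound the L^1 norm of the maximal function of |f|^p, and since
  that function is built from minima, layer cake reduces this to counting inside a unit cube.
  Let S be a set of centres whose faces all have average above t, let V be the set of the vertices
  in the directions +-(1,...,1), and let e bound the number of cells z in any coordinate space
  R^J, |J| = m, whose average is above t. A centre is determined by two opposite vertices, so
  |S| <= N^(1/2) |V| line by line; Loomis-Whitney gives |V| <= C e^(n/m); and |S| <= N^n.
  Interpolating, |S| <= C N^(m/(2n)) N^k e.

  Lower bound: let q be about delta^(-1/(2n)) and let E be the set of points of a fixed cube having
  at least m coordinates with some almost vanishing digit among the first 2n digits in base q.
  Then |E| is of order q^(-m) = delta^(m/(2n)) up to constants, while for each centre x one can
  choose the digits of r in [1,2] such that each of the 2n numbers x_i + r, x_i - r has such a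
  digit, so that all faces lie in E.
*)
theory Submission
  imports Defs
begin

section \<open>Powers in \<open>[0,\<infinity>]\<close> and neighbourhoods of faces\<close>

text \<open>The operator is not sublinear, so interpolating in p between endpoint estimates is not
  at hand; convexity on each single face takes its place, and the p-th root taken at the end keeps
  the constants independent of p. In the counting, the estimate from Loomis-Whitney is of order
  N^(1/2) e^(n/m). It is not linear in e unless m = n, while the integration over the levels t calls
  for a linear bound. The trivial bound N^n does not involve e; the weights m/n and 1 - m/n are
  those that make the combination linear in e. The root of N thereby becomes N^(m/(2n)), and N^k
  cancels against the factor N^m of the averages and the volume N^-n of a cell. The denominator 2n
  has the same origin in both bounds: a centre is recovered from the two vertices c + \<rho> and c -
  \<rho>, whence the square root, and a radius has to serve the 2n numbers x_i + r and x_i - r, each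
  of which receives a digit of its own. Neighbourhoods of width \<delta> blur all finer scales, so
  q^(2n) is kept below 1 / \<delta>, which fixes q.\<close>

lemma ennreal_powr_ennreal [simp]: "t \<ge> 0 \<Longrightarrow> ennreal_powr (ennreal t) a = ennreal (t powr a)"
  by (simp add: ennreal_powr_def)

lemma ennreal_powr_top [simp]: "ennreal_powr top a = top"
  by (simp add: ennreal_powr_def)

lemma ennreal_powr_mono:
  assumes "s \<le> t" "a \<ge> 0"
  shows "ennreal_powr s a \<le> ennreal_powr t a"
  using assms
  by (cases s rule: ennreal_cases; cases t rule: ennreal_cases)
     (auto intro!: ennreal_leI powr_mono2 simp: top_unique)

lemma ennreal_powr_mult_ennreal:
  assumes "c > 0"
  shows "ennreal_powr (ennreal c * t) a = ennreal (c powr a) * ennreal_powr t a"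
  using assms
  by (cases t rule: ennreal_cases)
     (auto simp: powr_mult ennreal_mult_top simp flip: ennreal_mult)

lemma ennreal_powr_powr_inverse:
  assumes "a > 0"
  shows "ennreal_powr (ennreal_powr t (1 / a)) a = t"
  using assms by (cases t rule: ennreal_cases) (auto simp: powr_powr)

lemma ennreal_powr_indicator:
  assumes "p > 0"
  shows "ennreal_powr (ennreal \<bar>indicator E y\<bar>) p = indicator E y"
  using assms by (auto simp: indicator_def)

section \<open>Coordinate boxes and the neighbourhoods of faces\<close>

lemma sets_lborel_vec_box:
  fixes A :: "'n::finite \<Rightarrow> real set"
  assumes "\<And>i. A i \<in> sets borel"
  shows "{y::real^'n. \<forall>i. y $ i \<in> A i} \<in> sets borel"
proof -
  have "{y::real^'n. \<forall>i. y $ i \<in> A i} = (\<Inter>i. (\<lambda>y. y $ i) -` A i)" by auto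
  moreover have "(\<lambda>y::real^'n. y $ i) -` A i \<in> sets borel" for i
    using measurable_sets[OF borel_measurable_continuous_onI[OF continuous_on_component[OF continuous_on_id, of UNIV i]] assms[of i]]
    by simp
  ultimately show ?thesis by (simp add: sets.countable_INT'' countable_finite)
qed

text \<open>The product formula for \<open>lborel\<close> runs over \<open>Basis\<close>; it is
  carried over to coordinates along \<open>\<lambda>i. axis i 1\<close>, whose inverse is
  \<open>axis_index\<close>.\<close>

lemma emeasure_lborel_vec_box:
  fixes A :: "'n::finite \<Rightarrow> real set"
  assumes [measurable]: "\<And>i. A i \<in> sets borel"
  shows "emeasure lborel {y::real^'n. \<forall>i. y $ i \<in> A i} = (\<Prod>i\<in>UNIV. emeasure lborel (A i))"
proof -
  define f :: "real^'n \<Rightarrow> real \<Rightarrow> ennreal" where "f = (\<lambda>b. indicator (A (axis_index b)))"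
  have inj: "inj_on (\<lambda>i::'n. axis i (1::real)) UNIV"
    by (rule inj_onI) (simp add: axis_eq_axis)
  have Basis: "(Basis :: (real^'n) set) = (\<lambda>i. axis i 1) ` UNIV"
    by (auto simp: Basis_vec_def)
  have ax: "axis_index (axis i (1::real)) = i" for i :: 'n
    by (metis axis_eq_axis axis_in_Basis_iff axis_index Basis_real_def insertI1 zero_neq_one)
  have "emeasure lborel {y::real^'n. \<forall>i. y $ i \<in> A i}
    = (\<integral>\<^sup>+y. indicator {y::real^'n. \<forall>i. y $ i \<in> A i} y \<partial>lborel)"
    using sets_lborel_vec_box[OF assms] by simp
  also have "\<dots> = (\<integral>\<^sup>+y. (\<Prod>b\<in>Basis. f b (y \<bullet> b)) \<partial>lborel)"
  proof (rule nn_integral_cong)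
    fix y :: "real^'n"
    have "(\<Prod>b\<in>Basis. f b (y \<bullet> b)) = (\<Prod>i\<in>UNIV. indicator (A i) (y $ i))"
      unfolding Basis by (simp add: prod.reindex[OF inj] f_def ax inner_axis)
    also have "\<dots> = indicator {y::real^'n. \<forall>i. y $ i \<in> A i} y"
      by (auto simp: indicator_def intro: prod_zero)
    finally show "indicator {y::real^'n. \<forall>i. y $ i \<in> A i} y = (\<Prod>b\<in>Basis. f b (y \<bullet> b))" ..
  qed
  also have "\<dots> = (\<Prod>b\<in>Basis. (\<integral>\<^sup>+x. f b x \<partial>lborel))"
    by (rule nn_integral_lborel_prod) (simp_all add: f_def)
  also have "\<dots> = (\<Prod>i\<in>UNIV. emeasure lborel (A i))"
    unfolding Basis by (simp add: prod.reindex[OF inj] f_def ax)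
  finally show ?thesis .
qed

lemma infnorm_less_iff_cart:
  fixes z :: "real^'n"
  shows "infnorm z < d \<longleftrightarrow> (\<forall>i. \<bar>z $ i\<bar> < d)"
  unfolding infnorm_Max by (auto simp: Basis_vec_def inner_axis)

text \<open>In the infinity norm the neighbourhood of a product is the product of the neighbourhoods
  of its factors. Face neighbourhoods are therefore boxes, and their measures are products of
  lengths.\<close>

lemma inf_nbhd_cube_face:
  fixes x :: "real^'n"
  assumes "r \<ge> 0" "\<delta> > 0"
  shows "inf_nbhd \<delta> (cube_face x r I P) =
    {y. \<forall>i. y $ i \<in> (if i \<in> I then {x $ i - (r + \<delta>)<..<x $ i + (r + \<delta>)}
      else {x $ i + (if i \<in> P then r else - r) - \<delta><..<x $ i + (if i \<in> P then r else - r) + \<delta>})}"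
    (is "_ = ?R")
proof (intro set_eqI iffI)
  fix y assume "y \<in> inf_nbhd \<delta> (cube_face x r I P)"
  then obtain u where u: "\<And>i. if i \<in> I then - r \<le> u $ i \<and> u $ i \<le> r else u $ i = (if i \<in> P then r else - r)"
    and d: "infnorm (y - (x + u)) < \<delta>"
    by (auto simp: inf_nbhd_def cube_face_def)
  have "\<bar>y $ i - x $ i - u $ i\<bar> < \<delta>" for i
    using d by (simp add: infnorm_less_iff_cart algebra_simps)
  then have "\<bar>y $ i - x $ i - u $ i\<bar> < \<delta>" "if i \<in> I then - r \<le> u $ i \<and> u $ i \<le> r else u $ i = (if i \<in> P then r else - r)" for i
    using u by blast+
  then show "y \<in> ?R" by (simp split: if_splits) (smt (verit))
next
  fix y assume y: "y \<in> ?R"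
  \<comment> \<open>Coordinatewise nearest point of the face: \<open>y - x\<close> is clamped to
    \<open>[-r, r]\<close> in the free coordinates.\<close>
  define u :: "real^'n" where
    "u = (\<chi> i. if i \<in> I then max (- r) (min r (y $ i - x $ i)) else if i \<in> P then r else - r)"
  have "x + u \<in> cube_face x r I P"
    using assms by (auto simp: cube_face_def u_def)
  moreover have "\<bar>(y - (x + u)) $ i\<bar> < \<delta>" for i
    using y[simplified, rule_format, of i] assms by (simp add: u_def split: if_splits) (smt (verit))+
  ultimately show "y \<in> inf_nbhd \<delta> (cube_face x r I P)"
    unfolding inf_nbhd_def infnorm_less_iff_cart by blast
qed

lemma
  fixes x :: "real^'n"
  assumes "r \<ge> 0" "\<delta> > 0"
  shows sets_inf_nbhd_cube_face: "inf_nbhd \<delta> (cube_face x r I P) \<in> sets borel"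
    and emeasure_inf_nbhd_cube_face: "emeasure lebesgue (inf_nbhd \<delta> (cube_face x r I P)) =
      ennreal ((2 * (r + \<delta>)) ^ card I * (2 * \<delta>) ^ card (- I))"
proof -
  let ?A = "\<lambda>i. if i \<in> I then {x $ i - (r + \<delta>)<..<x $ i + (r + \<delta>)}
      else {x $ i + (if i \<in> P then r else - r) - \<delta><..<x $ i + (if i \<in> P then r else - r) + \<delta>}"
  have A: "?A i \<in> sets borel" for i by simp
  show *: "inf_nbhd \<delta> (cube_face x r I P) \<in> sets borel"
    unfolding inf_nbhd_cube_face[OF assms] by (rule sets_lborel_vec_box[OF A])
  have "emeasure lebesgue (inf_nbhd \<delta> (cube_face x r I P)) = (\<Prod>i\<in>UNIV. emeasure lborel (?A i))"
    using * unfolding inf_nbhd_cube_face[OF assms]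
    by (subst emeasure_lborel_vec_box[OF A, symmetric]) simp
  also have "\<dots> = (\<Prod>i\<in>UNIV. ennreal (if i \<in> I then 2 * (r + \<delta>) else 2 * \<delta>))"
    using assms by (intro prod.cong refl) auto
  also have "\<dots> = ennreal (\<Prod>i\<in>UNIV. if i \<in> I then 2 * (r + \<delta>) else 2 * \<delta>)"
    using assms by (intro prod_ennreal) auto
  also have "(\<Prod>i\<in>UNIV. if i \<in> I then 2 * (r + \<delta>) else 2 * \<delta>) = (2 * (r + \<delta>)) ^ card I * (2 * \<delta>) ^ card (- I)"
    by (subst prod.If_cases) (auto simp: Collect_neg_eq)
  finally show "emeasure lebesgue (inf_nbhd \<delta> (cube_face x r I P)) =
      ennreal ((2 * (r + \<delta>)) ^ card I * (2 * \<delta>) ^ card (- I))" .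
qed

section \<open>Counting centres of skeletons in a grid\<close>

text \<open>Fibres with at most \<open>t\<close> points are deleted as long as there are any. Each
  deletion costs at most \<open>t\<close> points and destroys at least one value of one of the maps
  \<open>g i\<close>, so the strict inequality in the hypothesis survives it, and the process stops
  before the set is empty.\<close>

lemma exists_heavy_core:
  fixes g :: "'i \<Rightarrow> 'a \<Rightarrow> 'b" and t :: real
  assumes "finite B" "finite K" "t \<ge> 0" "t * (\<Sum>i\<in>K. real (card (g i ` B))) < real (card B)"
  shows "\<exists>B'\<subseteq>B. B' \<noteq> {} \<and> (\<forall>i\<in>K. \<forall>c\<in>B'. t < real (card {b\<in>B'. g i b = g i c}))"
  using assms(1,4)
proof (induction B rule: finite_psubset_induct)
  case (psubset B)
  have "B \<noteq> {}"
    using psubset.prems \<open>t \<ge> 0\<close> by (auto simp: sum_nonneg)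
  show ?case
  proof (cases "\<forall>i\<in>K. \<forall>c\<in>B. t < real (card {b\<in>B. g i b = g i c})")
    case True
    with \<open>B \<noteq> {}\<close> show ?thesis by (intro exI[of _ B] conjI) auto
  next
    case False
    then obtain i c where ic: "i \<in> K" "c \<in> B" "real (card {b\<in>B. g i b = g i c}) \<le> t"
      by (auto simp: not_less)
    define B1 where "B1 = B - {b\<in>B. g i b = g i c}"
    have sub: "B1 \<subset> B" using ic by (auto simp: B1_def)
    have "card B = card B1 + card {b\<in>B. g i b = g i c}"
      unfolding B1_def using psubset.hyps card_mono[of B "{b\<in>B. g i b = g i c}"]
      by (subst card_Diff_subset) auto
    then have c1: "real (card B) - t \<le> real (card B1)" using ic by simp
    have mono: "card (g j ` B1) \<le> card (g j ` B)" for j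
      using sub psubset.hyps by (intro card_mono) auto
    have "g i ` B1 \<subset> g i ` B"
    proof
      show "g i ` B1 \<subseteq> g i ` B" using sub by blast
      have "g i c \<notin> g i ` B1" by (auto simp: B1_def)
      then show "g i ` B1 \<noteq> g i ` B" using ic by blast
    qed
    then have less: "card (g i ` B1) < card (g i ` B)"
      using psubset.hyps by (intro psubset_card_mono) auto
    have "(\<Sum>j\<in>K. card (g j ` B1)) < (\<Sum>j\<in>K. card (g j ` B))"
      using mono less ic assms(2) by (intro sum_strict_mono_ex1) auto
    then have "(\<Sum>j\<in>K. card (g j ` B1)) + 1 \<le> (\<Sum>j\<in>K. card (g j ` B))" by simp
    then have "real ((\<Sum>j\<in>K. card (g j ` B1)) + 1) \<le> real (\<Sum>j\<in>K. card (g j ` B))"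
      by (rule of_nat_mono)
    then have "(\<Sum>j\<in>K. real (card (g j ` B1))) + 1 \<le> (\<Sum>j\<in>K. real (card (g j ` B)))" by simp
    then have "t * ((\<Sum>j\<in>K. real (card (g j ` B1))) + 1) \<le> t * (\<Sum>j\<in>K. real (card (g j ` B)))"
      using \<open>t \<ge> 0\<close> by (rule mult_left_mono)
    then have "t * (\<Sum>j\<in>K. real (card (g j ` B1))) < real (card B1)"
      using psubset.prems c1 by (simp add: algebra_simps)
    from psubset.IH[OF sub this] obtain B' where "B' \<subseteq> B1" "B' \<noteq> {}"
      "\<forall>i\<in>K. \<forall>c\<in>B'. t < real (card {b\<in>B'. g i b = g i c})"
      by (elim exE conjE)
    with sub show ?thesis by (intro exI[of _ B'] conjI) auto
  qed
qed

text \<open>Zeros outside \<open>J\<close> keep the points of all coordinate spaces in one type, so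
  that composing projections is intersecting index sets.\<close>

definition coord_proj :: "'n set \<Rightarrow> ('n \<Rightarrow> 'b::zero) \<Rightarrow> 'n \<Rightarrow> 'b" where
  "coord_proj J c = (\<lambda>i. if i \<in> J then c i else 0)"

lemma coord_proj_coord_proj [simp]: "coord_proj J (coord_proj K c) = coord_proj (J \<inter> K) c"
  by (auto simp: coord_proj_def fun_eq_iff)

lemma card_fibres_ge:
  assumes "finite A" "\<And>y. y \<in> g ` A \<Longrightarrow> t \<le> real (card {x\<in>A. g x = y})"
  shows "t * real (card (g ` A)) \<le> real (card A)"
proof -
  have "real (card A) = (\<Sum>y\<in>g ` A. real (card {x\<in>A. g x = y}))"
    using sum.image_gen[OF assms(1), of "\<lambda>_. 1::real" g] by simp
  moreover have "(\<Sum>y\<in>g ` A. t) \<le> (\<Sum>y\<in>g ` A. real (card {x\<in>A. g x = y}))"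
    by (rule sum_mono) (rule assms(2))
  ultimately show ?thesis by (simp add: mult.commute)
qed

text \<open>Over each point of the \<open>J\<close>-shadow lies the line in direction
  \<open>i\<close> through one of its preimages. The points of \<open>B\<close> on that line have
  distinct projections to \<open>insert i J\<close>, all above the given point, so each new
  coordinate multiplies the size of the shadow by at least \<open>t\<close>.\<close>

lemma power_le_card_coord_proj:
  fixes B :: "('n \<Rightarrow> 'b::zero) set"
  assumes "finite B" "B \<noteq> {}" "t \<ge> 0" "finite J"
    and heavy: "\<And>i c. i \<in> J \<Longrightarrow> c \<in> B \<Longrightarrow> t \<le> real (card {b\<in>B. coord_proj (- {i}) b = coord_proj (- {i}) c})"
  shows "t ^ card J \<le> real (card (coord_proj J ` B))"
  using assms(4) heavy
proof (induction J rule: finite_induct)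
  case empty
  have "coord_proj {} ` B = {\<lambda>_. 0}" using \<open>B \<noteq> {}\<close> by (auto simp: coord_proj_def)
  then show ?case by simp
next
  case (insert i J)
  let ?A = "coord_proj (insert i J) ` B"
  have img: "coord_proj J ` ?A = coord_proj J ` B"
    by (simp add: image_image Int_absorb2 subset_insertI)
  have "t * real (card (coord_proj J ` ?A)) \<le> real (card ?A)"
  proof (rule card_fibres_ge)
    show "finite ?A" using assms by simp
    fix y assume "y \<in> coord_proj J ` ?A"
    then obtain c where c: "c \<in> B" "y = coord_proj J c" unfolding img by blast
    let ?F = "{b\<in>B. coord_proj (- {i}) b = coord_proj (- {i}) c}"
    have off: "b j = c j" if "b \<in> ?F" "j \<noteq> i" for b j
      using that by (auto simp: coord_proj_def fun_eq_iff split: if_splits)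
    have "inj_on (coord_proj (insert i J)) ?F"
    proof (rule inj_onI)
      fix b b' assume b: "b \<in> ?F" "b' \<in> ?F" and eq: "coord_proj (insert i J) b = coord_proj (insert i J) b'"
      have "b i = b' i" using fun_cong[OF eq, of i] by (simp add: coord_proj_def)
      then show "b = b'" using off[OF b(1)] off[OF b(2)] by (metis ext)
    qed
    then have "card ?F = card (coord_proj (insert i J) ` ?F)" by (simp add: card_image)
    also have "\<dots> \<le> card {x\<in>?A. coord_proj J x = y}"
    proof (rule card_mono)
      show "coord_proj (insert i J) ` ?F \<subseteq> {x\<in>?A. coord_proj J x = y}"
      proof clarify
        fix b assume b: "b \<in> B" "coord_proj (- {i}) b = coord_proj (- {i}) c"
        have "coord_proj J b = coord_proj J c"
        proof
          fix j
          have "b j = c j" if "j \<in> J"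
            using that b insert.hyps by (intro off) auto
          then show "coord_proj J b j = coord_proj J c j" by (simp add: coord_proj_def)
        qed
        moreover have "J \<inter> insert i J = J" by blast
        ultimately show "coord_proj (insert i J) b \<in> ?A \<and> coord_proj J (coord_proj (insert i J) b) = y"
          using b c by simp
      qed
    qed (use assms in simp)
    finally show "t \<le> real (card {x\<in>?A. coord_proj J x = y})"
      using insert.prems[of i c] c by simp
  qed
  moreover have "t ^ card J \<le> real (card (coord_proj J ` B))"
    using insert.IH insert.prems by simp
  then have "t * t ^ card J \<le> t * real (card (coord_proj J ` B))"
    using \<open>t \<ge> 0\<close> by (rule mult_left_mono)
  ultimately show ?case
    using insert.hyps unfolding img by simp
qed

text \<open>
  Loomis--Whitney with a constant. If it failed for some \<open>K\<close>, then
  discarding the sparsely populated lines leaves a nonempty set all of whose lines in the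
  directions in \<open>K\<close> contain more than \<open>2 a\<close> points, and that set has too large a shadow.
\<close>
lemma card_coord_proj_le:
  fixes B :: "('n::finite \<Rightarrow> 'b::zero) set"
  assumes "finite B" "a > 0" "m \<ge> 1"
    and small: "\<And>J. card J = m \<Longrightarrow> real (card (coord_proj J ` B)) \<le> a ^ m"
    and "card K \<ge> m"
  shows "real (card (coord_proj K ` B)) \<le> (2 * real CARD('n) * a) ^ card K"
  using \<open>card K \<ge> m\<close>
proof (induction "card K" arbitrary: K rule: less_induct)
  case less
  let ?n = "real CARD('n)"
  have n1: "?n \<ge> 1" using zero_less_card_finite[where 'a = 'n] by linarith
  show ?case
  proof (cases "card K = m")
    case True
    have "a ^ m \<le> (2 * ?n * a) ^ m"
    proof (rule power_mono)
      have "1 * a \<le> 2 * ?n * a"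
        using n1 \<open>a > 0\<close> by (intro mult_right_mono) linarith+
      then show "a \<le> 2 * ?n * a" by simp
    qed (use \<open>a > 0\<close> in simp)
    then show ?thesis using small[OF True] True by simp
  next
    case False
    then have Km: "card K > m" using less.prems by simp
    let ?B = "coord_proj K ` B"
    have "real (card ?B) \<le> 2 * a * (\<Sum>i\<in>K. real (card (coord_proj (- {i}) ` ?B)))"
    proof (rule ccontr)
      assume "\<not> ?thesis"
      then have "2 * a * (\<Sum>i\<in>K. real (card (coord_proj (- {i}) ` ?B))) < real (card ?B)"
        by linarith
      with \<open>finite B\<close> \<open>a > 0\<close>
      have "\<exists>B'\<subseteq>?B. B' \<noteq> {} \<and> (\<forall>i\<in>K. \<forall>c\<in>B'.
          2 * a < real (card {b\<in>B'. coord_proj (- {i}) b = coord_proj (- {i}) c}))"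
        by (intro exists_heavy_core) simp_all
      then obtain B' where B': "B' \<subseteq> ?B" "B' \<noteq> {}"
        and heavy: "\<And>i c. i \<in> K \<Longrightarrow> c \<in> B' \<Longrightarrow>
          2 * a < real (card {b\<in>B'. coord_proj (- {i}) b = coord_proj (- {i}) c})"
        by blast
      obtain J where J: "J \<subseteq> K" "card J = m"
        using obtain_subset_with_card_n[of m K] Km by (metis less_imp_le)
      have "(2 * a) ^ card J \<le> real (card (coord_proj J ` B'))"
      proof (rule power_le_card_coord_proj)
        show "finite B'" using B' \<open>finite B\<close> by (meson finite_imageI finite_subset)
        show "2 * a \<le> real (card {b\<in>B'. coord_proj (- {i}) b = coord_proj (- {i}) c})"
          if "i \<in> J" "c \<in> B'" for i c
          using heavy[of i c] that J by (simp add: subset_iff)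
      qed (use B' \<open>a > 0\<close> in auto)
      also have "\<dots> \<le> real (card (coord_proj J ` ?B))"
        using B' assms by (intro of_nat_mono card_mono) auto
      also have "coord_proj J ` ?B = coord_proj J ` B"
        using J by (simp add: image_image Int_absorb2)
      also have "real (card \<dots>) \<le> a ^ m" using small J by simp
      finally have "(2 * a) ^ m \<le> a ^ m" using J by simp
      moreover have "a ^ m < (2 * a) ^ m"
        using assms by (intro power_strict_mono) auto
      ultimately show False by simp
    qed
    also have "\<dots> \<le> 2 * a * (\<Sum>i\<in>K. (2 * ?n * a) ^ (card K - 1))"
    proof (intro mult_left_mono sum_mono)
      fix i assume i: "i \<in> K"
      have "coord_proj (- {i}) ` ?B = coord_proj (K - {i}) ` B"
        by (simp add: image_image Diff_eq Int_commute)
      moreover have "card (K - {i}) = card K - 1" using i by simp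
      ultimately show "real (card (coord_proj (- {i}) ` ?B)) \<le> (2 * ?n * a) ^ (card K - 1)"
        using less.hyps[of "K - {i}"] Km by simp
    qed (use assms in auto)
    \<comment> \<open>The sum over the directions in \<open>K\<close> costs a factor
      \<open>card K \<le> n\<close>; this is the \<open>n\<close> in the constant
      \<open>2 n a\<close> per dimension.\<close>
    also have "\<dots> \<le> 2 * ?n * a * (2 * ?n * a) ^ (card K - 1)"
    proof -
      have "real (card K) \<le> ?n" by (simp add: card_mono)
      then have "2 * a * real (card K) * (2 * ?n * a) ^ (card K - 1) \<le> 2 * a * ?n * (2 * ?n * a) ^ (card K - 1)"
        using assms by (intro mult_right_mono mult_left_mono) auto
      then show ?thesis by (simp add: mult_ac)
    qed
    also have "\<dots> = (2 * ?n * a) ^ card K"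
      using Km by (cases "card K") auto
    finally show ?thesis .
  qed
qed

text \<open>
  On each line in direction \<open>(1,\<dots>,1)\<close> a centre is determined by two of its opposite
  vertices, so a line with \<open>s\<close> centres has at least \<open>sqrt s\<close> vertices, while \<open>s \<le> N\<close>.
\<close>
lemma card_centres_le:
  fixes S E :: "('n \<Rightarrow> int) set" and l :: int and N :: nat
  assumes "finite E" "finite S" and range: "\<And>c. c \<in> S \<Longrightarrow> c i0 \<in> {l..<l + int N}"
    and vert: "\<And>c. c \<in> S \<Longrightarrow> \<exists>\<rho>. (\<lambda>i. c i + \<rho>) \<in> E \<and> (\<lambda>i. c i - \<rho>) \<in> E"
  shows "real (card S) \<le> sqrt (real N) * real (card E)"
proof -
  define g :: "('n \<Rightarrow> int) \<Rightarrow> 'n \<Rightarrow> int" where "g = (\<lambda>c i. c i - c i0)"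
  have "real (card S) = (\<Sum>y\<in>g ` S. real (card {x\<in>S. g x = y}))"
    using sum.image_gen[OF assms(2), of "\<lambda>_. 1::real" g] by simp
  also have "\<dots> \<le> (\<Sum>y\<in>g ` S. sqrt (real N) * real (card {x\<in>E. g x = y}))"
  proof (rule sum_mono)
    fix y assume "y \<in> g ` S"
    let ?S = "{x\<in>S. g x = y}" and ?E = "{x\<in>E. g x = y}"
    have "inj_on (\<lambda>c. c i0) ?S"
    proof (rule inj_onI)
      fix c c' assume "c \<in> ?S" "c' \<in> ?S" and eq: "c i0 = c' i0"
      then have "g c = g c'" by simp
      then have "c i = c' i" for i using eq unfolding g_def fun_eq_iff by (metis diff_add_cancel)
      then show "c = c'" by blast
    qed
    then have "card ?S \<le> card {l..<l + int N}"
      using range by (intro card_inj_on_le[where f = "\<lambda>c. c i0"]) auto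
    then have cN: "card ?S \<le> N" by simp
    obtain \<rho> where \<rho>: "\<And>c. c \<in> S \<Longrightarrow> (\<lambda>i. c i + \<rho> c) \<in> E \<and> (\<lambda>i. c i - \<rho> c) \<in> E"
      using vert by metis
    let ?h = "\<lambda>c. (\<lambda>i. c i + \<rho> c, \<lambda>i. c i - \<rho> c)"
    have "inj_on ?h ?S"
    proof (rule inj_onI)
      fix c c' assume "?h c = ?h c'"
      then have "c i + \<rho> c = c' i + \<rho> c'" "c i - \<rho> c = c' i - \<rho> c'" for i
        by (metis prod.inject)+
      then have "c i = c' i" for i by (smt (verit))
      then show "c = c'" by blast
    qed
    moreover have "?h ` ?S \<subseteq> ?E \<times> ?E" using \<rho> by (auto simp: g_def)
    ultimately have "card ?S \<le> card (?E \<times> ?E)"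
      using assms(1) by (intro card_inj_on_le) auto
    \<comment> \<open>One factor is bounded by \<open>N\<close>, the other by
      \<open>(card ?E)^2\<close>. The resulting geometric mean is linear in \<open>card ?E\<close>,
      so the lines can be added up.\<close>
    then have "card ?S * card ?S \<le> N * (card ?E)^2"
      using cN by (intro mult_mono) (auto simp: card_cartesian_product power2_eq_square)
    then have "real (card ?S * card ?S) \<le> real (N * (card ?E)^2)" by (rule of_nat_mono)
    then have "(real (card ?S))^2 \<le> real N * (real (card ?E))^2"
      by (simp add: power2_eq_square)
    then have "real (card ?S) \<le> sqrt (real N * (real (card ?E))^2)"
      by (simp add: real_le_rsqrt)
    then show "real (card ?S) \<le> sqrt (real N) * real (card ?E)"
      by (simp add: real_sqrt_mult)
  qed
  also have "\<dots> \<le> (\<Sum>y\<in>g ` E. sqrt (real N) * real (card {x\<in>E. g x = y}))"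
  proof (rule sum_mono2)
    show "g ` S \<subseteq> g ` E"
    proof clarify
      fix c assume "c \<in> S"
      then obtain \<rho> where "(\<lambda>i. c i + \<rho>) \<in> E" using vert by blast
      moreover have "g (\<lambda>i. c i + \<rho>) = g c" by (simp add: g_def)
      ultimately show "g c \<in> g ` E" using imageI[of "\<lambda>i. c i + \<rho>" E g] by simp
    qed
  qed (use assms in auto)
  also have "\<dots> = sqrt (real N) * real (card E)"
    using sum.image_gen[OF assms(1), of "\<lambda>_. 1::real" g] by (simp add: sum_distrib_left)
  finally show ?thesis .
qed

section \<open>The interpolated bound for the number of centres\<close>

lemma card_skeleton_centres_le:
  fixes S :: "('n::finite \<Rightarrow> int) set" and E :: "'n set \<Rightarrow> ('n \<Rightarrow> int) set"
    and l :: "'n \<Rightarrow> int" and N m :: nat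
  assumes m: "1 \<le> m" "m \<le> CARD('n)" and "N \<ge> 1" and e: "e > 0"
    and range: "\<And>c i. c \<in> S \<Longrightarrow> c i \<in> {l i..<l i + int N}"
    and finE: "\<And>J. card J = m \<Longrightarrow> finite (E J)"
    and cardE: "\<And>J. card J = m \<Longrightarrow> real (card (E J)) \<le> e"
    and vert: "\<And>c. c \<in> S \<Longrightarrow> \<exists>\<rho>. \<forall>J. card J = m \<longrightarrow>
      coord_proj J (\<lambda>i. c i + \<rho>) \<in> E J \<and> coord_proj J (\<lambda>i. c i - \<rho>) \<in> E J"
  shows "real (card S) \<le> (2 * real CARD('n)) ^ CARD('n) *
    (real N powr (real m / (2 * real CARD('n))) * real N ^ (CARD('n) - m) * e)"
proof -
  let ?n = "CARD('n)"
  define L where "L = (2 * real ?n) ^ ?n"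
  have n1: "real ?n \<ge> 1" using zero_less_card_finite[where 'a = 'n] by linarith
  then have L1: "L \<ge> 1" unfolding L_def by (intro one_le_power) linarith
  have "S \<subseteq> PiE UNIV (\<lambda>i. {l i..<l i + int N})" using range by auto
  moreover have fin: "finite (PiE (UNIV::'n set) (\<lambda>i. {l i..<l i + int N}))"
    by (intro finite_PiE) auto
  ultimately have finS: "finite S" and "card S \<le> card (PiE UNIV (\<lambda>i. {l i..<l i + int N}))"
    by (auto intro: finite_subset card_mono)
  then have "card S \<le> N ^ ?n" by (simp add: card_PiE)
  then have cS: "real (card S) \<le> real N ^ ?n" by (metis of_nat_le_iff of_nat_power)
  \<comment> \<open>One radius per centre serves all \<open>J\<close> at once; hence the vertices
    \<open>c + \<rho> c\<close> and \<open>c - \<rho> c\<close> are points all of whose projections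
    lie in the sets \<open>E J\<close>.\<close>
  obtain \<rho> where \<rho>: "\<And>c J. c \<in> S \<Longrightarrow> card J = m \<Longrightarrow>
      coord_proj J (\<lambda>i. c i + \<rho> c) \<in> E J \<and> coord_proj J (\<lambda>i. c i - \<rho> c) \<in> E J"
    using vert by metis
  define V where "V = (\<lambda>c i. c i + \<rho> c) ` S \<union> (\<lambda>c i. c i - \<rho> c) ` S"
  have finV: "finite V" using finS by (simp add: V_def)
  define a where "a = e powr (1 / real m)"
  have a: "a > 0" "a ^ m = e"
    using e m by (auto simp: a_def powr_powr simp flip: powr_realpow)
  have "real (card (coord_proj J ` V)) \<le> a ^ m" if J: "card J = m" for J
  proof -
    have "coord_proj J ` V \<subseteq> E J" using \<rho> J by (auto simp: V_def)
    then have "real (card (coord_proj J ` V)) \<le> real (card (E J))"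
      using finE[OF J] by (intro of_nat_mono card_mono) auto
    with cardE[OF J] show ?thesis using a by simp
  qed
  from card_coord_proj_le[OF finV a(1) m(1) this, of UNIV] m
  have "real (card (coord_proj UNIV ` V)) \<le> (2 * real ?n * a) ^ ?n" by simp
  moreover have "coord_proj UNIV ` V = V" by (auto simp: coord_proj_def)
  ultimately have cV: "real (card V) \<le> L * a ^ ?n"
    by (simp add: L_def power_mult_distrib)
  \<comment> \<open>Every coordinate parametrises the lines in direction
    \<open>(1,\<dots>,1)\<close>, so any one of them will do.\<close>
  obtain i0 :: 'n where True by blast
  have "real (card S) \<le> sqrt (real N) * real (card V)"
  proof (rule card_centres_le[OF finV finS])
    show "c i0 \<in> {l i0..<l i0 + int N}" if "c \<in> S" for c using range[OF that] .
    show "\<exists>\<rho>. (\<lambda>i. c i + \<rho>) \<in> V \<and> (\<lambda>i. c i - \<rho>) \<in> V" if "c \<in> S" for c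
      using that unfolding V_def by blast
  qed
  also have "\<dots> \<le> sqrt (real N) * (L * a ^ ?n)"
    using cV by (intro mult_left_mono) auto
  finally have S1: "real (card S) \<le> sqrt (real N) * (L * a ^ ?n)" .
  define s where "s = real (card S)"
  show ?thesis
  proof (cases "s = 0")
    case True
    then show ?thesis using e by (simp add: s_def)
  next
    case False
    then have s: "s > 0" by (simp add: s_def)
    \<comment> \<open>Raised to the power m/n, \<open>a ^ n\<close> becomes
      \<open>a ^ m = e\<close>. The remaining power 1 - m/n of \<open>N ^ n\<close> is
      \<open>N ^ (n - m)\<close>.\<close>
    define u where "u = real m / real ?n"
    have u: "0 \<le> u" "u \<le> 1" using m by (auto simp: u_def)
    have N: "real N > 0" using \<open>N \<ge> 1\<close> by simp
    have "s = s powr u * s powr (1 - u)" using s by (simp flip: powr_add)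
    also have "s powr u \<le> (sqrt (real N) * (L * a ^ ?n)) powr u"
      using S1 s u by (intro powr_mono2) (auto simp: s_def)
    also have "\<dots> = real N powr (u / 2) * (L powr u * a ^ m)"
    proof -
      have "sqrt (real N) powr u = real N powr (u / 2)"
        using N by (simp add: powr_half_sqrt[symmetric] powr_powr)
      moreover have "(a ^ ?n) powr u = a ^ m"
        using a by (simp add: u_def powr_powr flip: powr_realpow)
      ultimately show ?thesis using L1 a N by (simp add: powr_mult)
    qed
    also have "\<dots> \<le> real N powr (u / 2) * (L * e)"
      using L1 u e a powr_mono[of u 1 L] by (intro mult_left_mono mult_mono) auto
    also have "s powr (1 - u) \<le> (real N ^ ?n) powr (1 - u)"
      using cS s u by (intro powr_mono2) (auto simp: s_def)
    also have "(real N ^ ?n) powr (1 - u) = real N ^ (?n - m)"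
    proof -
      have "real ?n * (1 - u) = real (?n - m)" using m n1 by (simp add: u_def field_simps of_nat_diff)
      then show ?thesis using N by (simp add: powr_powr flip: powr_realpow)
    qed
    finally have "s \<le> real N powr (u / 2) * (L * e) * real N ^ (?n - m)"
      using e L1 by (simp add: mult_right_mono mult_left_mono)
    then show ?thesis by (simp add: s_def u_def L_def mult_ac)
  qed
qed

section \<open>The upper bound\<close>

text \<open>Layer cake for a single value: it turns sums of values into integrals over
  \<open>t\<close> of cardinalities of level sets. Infinite values are included because the mass of
  a slab may be infinite.\<close>

lemma emeasure_superlevel_ennreal: "emeasure lborel {t. 0 \<le> t \<and> ennreal t < X} = X"
proof (cases X rule: ennreal_cases)
  case (real a)
  then have "{t. 0 \<le> t \<and> ennreal t < X} = {0..<a}" by (auto simp: ennreal_less_iff)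
  then show ?thesis using real by simp
next
  case top
  have "ennreal (real n) \<le> emeasure lborel {0::real..}" for n
  proof -
    have "ennreal (real n) = emeasure lborel {0..real n}" by simp
    also have "\<dots> \<le> emeasure lborel {0::real..}" by (intro emeasure_mono) auto
    finally show ?thesis .
  qed
  then have "emeasure lborel {0::real..} = top"
    by (metis ennreal_of_nat_eq_real_of_nat ennreal_Ex_less_of_nat less_top linorder_not_less)
  moreover have "{t. 0 \<le> t \<and> ennreal t < X} = {0..}" using top by auto
  ultimately show ?thesis using top by simp
qed

text \<open>
  Jensen's inequality up to the factor 2, from the pointwise bound
  \<open>u \<le> l + l powr (1 - p) * u powr p\<close> with \<open>l\<close> close to the \<open>L\<^sup>p\<close> average.
\<close>
lemma abs_average_le_powr_average:
  fixes f :: "'a::euclidean_space \<Rightarrow> real"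
  assumes [measurable]: "f \<in> borel_measurable lebesgue" "S \<in> sets lebesgue"
    and s: "emeasure lebesgue S = ennreal s" "s > 0" and "p \<ge> 1"
  shows "abs_average S f \<le>
    2 * ennreal_powr ((\<integral>\<^sup>+y\<in>S. ennreal (\<bar>f y\<bar> powr p) \<partial>lebesgue) / ennreal s) (1 / p)"
proof (cases "(\<integral>\<^sup>+y\<in>S. ennreal (\<bar>f y\<bar> powr p) \<partial>lebesgue) / ennreal s" rule: ennreal_cases)
  case top
  then show ?thesis by (simp add: ennreal_mult_top)
next
  case (real w)
  let ?I = "\<integral>\<^sup>+y\<in>S. ennreal (\<bar>f y\<bar> powr p) \<partial>lebesgue"
  have "ennreal s / ennreal s = 1"
    using s by (intro ennreal_divide_self) (auto simp: ennreal_eq_0_iff)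
  then have "?I = ?I / ennreal s * ennreal s" by (simp only: ennreal_divide_times mult_1_right)
  also have "\<dots> = ennreal w * ennreal s" by (simp only: real(2))
  finally have I: "?I = ennreal (w * s)" using real s by (simp only: ennreal_mult less_imp_le)
  have "abs_average S f \<le> ennreal (2 * w powr (1 / p)) + ennreal e" if e: "e > 0" for e
  proof -
    \<comment> \<open>The summand \<open>e / 2\<close> keeps \<open>l\<close> positive when the
      average \<open>w\<close> vanishes; it disappears when \<open>e\<close> tends to 0.\<close>
    define l where "l = w powr (1 / p) + e / 2"
    have l: "l > 0" using e by (simp add: l_def add_nonneg_pos)
    have "w = (w powr (1 / p)) powr p" using real \<open>p \<ge> 1\<close> by (simp add: powr_powr)
    also have "\<dots> \<le> l powr p" using e \<open>p \<ge> 1\<close> by (intro powr_mono2) (auto simp: l_def)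
    finally have wl: "w \<le> l powr p" .
    have pt: "u \<le> l + l powr (1 - p) * u powr p" if "u \<ge> 0" for u
    proof (cases "u \<le> l")
      case True
      then show ?thesis by (simp add: add_increasing2)
    next
      case False
      then have "u = u powr (1 - p) * u powr p" using l by (simp flip: powr_add)
      also have "\<dots> \<le> l powr (1 - p) * u powr p"
        using False l \<open>p \<ge> 1\<close> by (intro mult_right_mono powr_mono2') auto
      finally show ?thesis using l by simp
    qed
    have "(\<integral>\<^sup>+y\<in>S. ennreal \<bar>f y\<bar> \<partial>lebesgue)
      \<le> (\<integral>\<^sup>+y. ennreal l * indicator S y + ennreal (l powr (1 - p)) * (ennreal (\<bar>f y\<bar> powr p) * indicator S y) \<partial>lebesgue)"
    proof (rule nn_integral_mono)
      fix y
      have "ennreal \<bar>f y\<bar> \<le> ennreal (l + l powr (1 - p) * \<bar>f y\<bar> powr p)"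
        by (intro ennreal_leI pt) simp
      then show "ennreal \<bar>f y\<bar> * indicator S y \<le> ennreal l * indicator S y
          + ennreal (l powr (1 - p)) * (ennreal (\<bar>f y\<bar> powr p) * indicator S y)"
        using l by (auto simp: indicator_def ennreal_plus ennreal_mult)
    qed
    also have "\<dots> = ennreal l * ennreal s + ennreal (l powr (1 - p)) * ?I"
      by (subst nn_integral_add) (simp_all add: nn_integral_cmult s(1)[symmetric])
    also have "\<dots> = ennreal (l * s + l powr (1 - p) * (w * s))"
      using l s real unfolding I by (simp add: ennreal_plus ennreal_mult)
    also have "\<dots> \<le> ennreal (l * s + l powr (1 - p) * (l powr p * s))"
      using wl s by (intro ennreal_leI add_left_mono mult_left_mono mult_right_mono) auto
    also have "l * s + l powr (1 - p) * (l powr p * s) = l * s + (l powr (1 - p) * l powr p) * s"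
      by (simp only: mult.assoc)
    also have "l powr (1 - p) * l powr p = l" using l by (simp flip: powr_add)
    also have "l * s + l * s = s * (2 * l)" by simp
    also have "ennreal (s * (2 * l)) = ennreal s * ennreal (2 * l)"
      using s(2) l by (intro ennreal_mult) simp_all
    finally have "(\<integral>\<^sup>+y\<in>S. ennreal \<bar>f y\<bar> \<partial>lebesgue) \<le> ennreal s * ennreal (2 * l)" .
    moreover have "ennreal s > 0" using s(2) by simp
    ultimately have "abs_average S f \<le> ennreal (2 * l)"
      unfolding abs_average_def s(1) by (intro divide_le_posI_ennreal)
    also have "2 * l = 2 * w powr (1 / p) + e" by (simp add: l_def)
    also have "ennreal \<dots> = ennreal (2 * w powr (1 / p)) + ennreal e"
      using e by (intro ennreal_plus) simp_all
    finally show ?thesis .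
  qed
  then have "abs_average S f \<le> ennreal (2 * w powr (1 / p))"
    by (rule ennreal_le_epsilon)
  also have "ennreal (2 * w powr (1 / p)) = 2 * ennreal (w powr (1 / p))" by (simp add: ennreal_mult)
  finally show ?thesis unfolding real(2) using real(1) by simp
qed

section \<open>Discretisation on the grid of mesh 1 / N\<close>

definition grid_cell :: "nat \<Rightarrow> real^'n \<Rightarrow> 'n \<Rightarrow> int" where
  "grid_cell N x = (\<lambda>i. \<lfloor>real N * x $ i\<rfloor>)"

text \<open>
  The index \<open>w\<close> is a unit cube and \<open>z\<close> a cell of the grid of mesh \<open>1 / N\<close>. The tolerance 3 absorbs
  both \<open>r + \<delta> < 3\<close> in units of \<open>1\<close> and \<open>\<delta> \<le> 2 / N\<close> plus rounding in units of \<open>1 / N\<close>.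
\<close>
definition local_slab :: "nat \<Rightarrow> ('n \<Rightarrow> int) \<Rightarrow> 'n set \<Rightarrow> ('n \<Rightarrow> int) \<Rightarrow> (real^'n) set" where
  "local_slab N w J z = {y. (\<forall>i. \<bar>grid_cell 1 y i - w i\<bar> \<le> 3) \<and> (\<forall>i\<in>J. \<bar>grid_cell N y i - z i\<bar> \<le> 3)}"

definition slab_mass ::
  "nat \<Rightarrow> (real^'n \<Rightarrow> ennreal) \<Rightarrow> ('n \<Rightarrow> int) \<Rightarrow> 'n set \<Rightarrow> ('n \<Rightarrow> int) \<Rightarrow> ennreal" where
  "slab_mass N \<phi> w J z = (\<integral>\<^sup>+y\<in>local_slab N w J z. \<phi> y \<partial>lebesgue)"

text \<open>The index \<open>\<rho>\<close> stands for the integer part of \<open>N r\<close> with r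
  in [1,2]. Of all faces only those through the vertices in the directions (1,...,1) and (-1,...,-1)
  are kept, which can only increase the minimum. Masses replace averages; the normalising factor
  \<open>N ^ m\<close> is the same for all \<open>J\<close> and is restored later.\<close>

definition grid_maximal ::
  "nat \<Rightarrow> nat \<Rightarrow> (real^'n \<Rightarrow> ennreal) \<Rightarrow> ('n \<Rightarrow> int) \<Rightarrow> ('n \<Rightarrow> int) \<Rightarrow> ennreal" where
  "grid_maximal m N \<phi> w c = (SUP \<rho>\<in>{int N..2 * int N}. INF J\<in>{J. card J = m}.
     min (slab_mass N \<phi> w J (\<lambda>i. c i + \<rho>)) (slab_mass N \<phi> w J (\<lambda>i. c i - \<rho>)))"

lemma grid_cell_measurable [measurable]:
  "grid_cell N \<in> measurable borel (count_space (UNIV :: ('n::finite \<Rightarrow> int) set))"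
proof (subst measurable_count_space_eq2_countable, intro conjI ballI)
  fix c :: "'n \<Rightarrow> int"
  have *: "{t. \<lfloor>real N * t\<rfloor> = c i} \<in> sets borel" for i
  proof -
    have "(\<lambda>t. \<lfloor>real N * t\<rfloor>) -` {c i} \<inter> space borel \<in> sets borel"
      by (rule measurable_sets[of _ _ "count_space UNIV"]) simp_all
    then show ?thesis by (simp add: vimage_def)
  qed
  have "grid_cell N -` {c} = {x::real^'n. \<forall>i. x $ i \<in> {t. \<lfloor>real N * t\<rfloor> = c i}}"
    by (auto simp: grid_cell_def fun_eq_iff)
  then show "grid_cell N -` {c} \<inter> space borel \<in> sets (borel :: (real^'n) measure)"
    using sets_lborel_vec_box[OF *] by simp
qed auto

lemma emeasure_grid_cell:
  fixes c :: "'n::finite \<Rightarrow> int"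
  assumes "N \<ge> 1"
  shows "emeasure lebesgue {x. grid_cell N x = c} = ennreal ((1 / real N) ^ CARD('n))"
proof -
  have set: "{x. grid_cell N x = c} = {x::real^'n. \<forall>i. x $ i \<in> {of_int (c i) / real N..<(of_int (c i) + 1) / real N}}"
    using assms by (auto simp: grid_cell_def fun_eq_iff floor_eq_iff field_simps)
  have "emeasure lebesgue {x. grid_cell N x = c}
    = (\<Prod>i\<in>UNIV. emeasure lborel {of_int (c i) / real N..<(of_int (c i) + 1) / real N})"
    unfolding set by (subst emeasure_lborel_vec_box[symmetric]) (simp_all add: sets_lborel_vec_box)
  also have "\<dots> = (\<Prod>i\<in>(UNIV::'n set). ennreal (1 / real N))"
    using assms by (intro prod.cong refl) (simp add: divide_right_mono diff_divide_distrib[symmetric])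
  also have "\<dots> = ennreal ((1 / real N) ^ CARD('n))"
    by (simp add: ennreal_power)
  finally show ?thesis .
qed

lemma sets_local_slab [measurable]: "local_slab N w J z \<in> sets (borel :: (real^'n::finite) measure)"
proof -
  have "local_slab N w J z = (grid_cell 1 -` {v. \<forall>i. \<bar>v i - w i\<bar> \<le> 3} \<inter> space borel)
      \<inter> (grid_cell N -` {v. \<forall>i\<in>J. \<bar>v i - z i\<bar> \<le> 3} \<inter> space borel)"
    by (auto simp: local_slab_def)
  also have "\<dots> \<in> sets borel"
    by (intro sets.Int measurable_sets[OF grid_cell_measurable]) auto
  finally show ?thesis .
qed

lemma inf_nbhd_cube_face_subset_local_slab:
  fixes x :: "real^'n::finite"
  assumes r: "r \<in> {1..2}" and \<delta>: "0 < \<delta>" "\<delta> < 1" and N: "N \<ge> 1" "real N * \<delta> \<le> 2"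
    and \<rho>: "\<rho> = \<lfloor>real N * r\<rfloor>"
  shows "inf_nbhd \<delta> (cube_face x r I (if b then UNIV else {}))
    \<subseteq> local_slab N (grid_cell 1 x) (- I) (\<lambda>i. grid_cell N x i + (if b then \<rho> else - \<rho>))"
proof
  fix y assume "y \<in> inf_nbhd \<delta> (cube_face x r I (if b then UNIV else {}))"
  then have y: "y $ i \<in> (if i \<in> I then {x $ i - (r + \<delta>)<..<x $ i + (r + \<delta>)}
      else {x $ i + (if b then r else - r) - \<delta><..<x $ i + (if b then r else - r) + \<delta>})" for i
    using inf_nbhd_cube_face[of r \<delta> x I] r \<delta> by (auto split: if_splits)
  have "\<bar>\<lfloor>y $ i\<rfloor> - \<lfloor>x $ i\<rfloor>\<bar> \<le> 3" for i
  proof -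
    have "\<bar>y $ i - x $ i\<bar> < 3" using y[of i] r \<delta> by (auto split: if_splits simp: abs_less_iff)
    then show ?thesis by linarith
  qed
  moreover have "\<bar>\<lfloor>real N * y $ i\<rfloor> - (\<lfloor>real N * x $ i\<rfloor> + (if b then \<rho> else - \<rho>))\<bar> \<le> 3" if "i \<notin> I" for i
  proof -
    have "\<bar>y $ i - x $ i - (if b then r else - r)\<bar> < \<delta>" using y[of i] that by (auto simp: abs_less_iff)
    then have "real N * \<bar>y $ i - x $ i - (if b then r else - r)\<bar> < real N * \<delta>"
      using N(1) by (intro mult_strict_left_mono) auto
    then have "\<bar>real N * (y $ i - x $ i - (if b then r else - r))\<bar> < 2"
      using N(2) by (simp add: abs_mult)
    then have "\<bar>real N * y $ i - real N * x $ i - (if b then real N * r else - (real N * r))\<bar> < 2"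
      by (simp add: algebra_simps split: if_splits)
    \<comment> \<open>Passing to integer parts changes the difference by three fractional parts with
      mixed signs, hence by less than 2. With the distance below 2 this gives an integer of absolute
      value below 4.\<close>
    then show ?thesis unfolding \<rho> by (cases b; simp only: if_True if_False; linarith)
  qed
  ultimately show "y \<in> local_slab N (grid_cell 1 x) (- I) (\<lambda>i. grid_cell N x i + (if b then \<rho> else - \<rho>))"
    by (simp add: local_slab_def grid_cell_def)
qed

text \<open>The sides of the box are at least 1 in the directions of \<open>I\<close> and at least 1
  / N in the m others, so dividing by its measure costs at most \<open>N ^ m\<close>.\<close>

lemma abs_average_cube_face_le:
  fixes x :: "real^'n::finite" and f :: "real^'n \<Rightarrow> real"
  assumes f: "f \<in> borel_measurable lebesgue" and "p \<ge> 1"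
    and r: "r \<in> {1..2}" and \<delta>: "0 < \<delta>" "\<delta> < 1" and N: "N \<ge> 1" "real N * \<delta> \<le> 2" "1 \<le> real N * \<delta>"
    and sub: "inf_nbhd \<delta> (cube_face x r I P) \<subseteq> T" and "card (- I) = m"
  shows "abs_average (inf_nbhd \<delta> (cube_face x r I P)) f \<le>
    2 * ennreal_powr (ennreal (real N ^ m) * (\<integral>\<^sup>+y\<in>T. ennreal (\<bar>f y\<bar> powr p) \<partial>lebesgue)) (1 / p)"
proof -
  let ?S = "inf_nbhd \<delta> (cube_face x r I P)"
  define s where "s = (2 * (r + \<delta>)) ^ card I * (2 * \<delta>) ^ m"
  have s: "emeasure lebesgue ?S = ennreal s" "s > 0"
    using emeasure_inf_nbhd_cube_face[of r \<delta> x I P] r \<delta> assms by (simp_all add: s_def)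
  have S: "?S \<in> sets lebesgue" using sets_inf_nbhd_cube_face[of r \<delta> x I P] r \<delta> by simp
  have "1 * (1 / real N) ^ m \<le> (2 * (r + \<delta>)) ^ card I * (2 * \<delta>) ^ m"
  proof (intro mult_mono one_le_power power_mono)
    have "1 / real N \<le> \<delta>" using N by (simp add: field_simps)
    then show "1 / real N \<le> 2 * \<delta>" using \<delta> by linarith
  qed (use r \<delta> in auto)
  then have "1 / real N ^ m \<le> s" by (simp add: s_def power_one_over)
  then have "1 / s \<le> real N ^ m" using s(2) N(1) by (simp add: field_simps)
  then have inv: "inverse (ennreal s) \<le> ennreal (real N ^ m)"
    using s(2) by (simp add: inverse_ennreal inverse_eq_divide ennreal_leI)
  have "abs_average ?S f \<le> 2 * ennreal_powr ((\<integral>\<^sup>+y\<in>?S. ennreal (\<bar>f y\<bar> powr p) \<partial>lebesgue) / ennreal s) (1 / p)"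
    by (rule abs_average_le_powr_average[OF f S s \<open>p \<ge> 1\<close>])
  also have "\<dots> \<le> 2 * ennreal_powr (ennreal (real N ^ m) * (\<integral>\<^sup>+y\<in>T. ennreal (\<bar>f y\<bar> powr p) \<partial>lebesgue)) (1 / p)"
  proof (intro mult_left_mono ennreal_powr_mono)
    have "(\<integral>\<^sup>+y\<in>?S. ennreal (\<bar>f y\<bar> powr p) \<partial>lebesgue) \<le> (\<integral>\<^sup>+y\<in>T. ennreal (\<bar>f y\<bar> powr p) \<partial>lebesgue)"
      using sub by (intro nn_integral_mono) (auto simp: indicator_def)
    then show "(\<integral>\<^sup>+y\<in>?S. ennreal (\<bar>f y\<bar> powr p) \<partial>lebesgue) / ennreal s
      \<le> ennreal (real N ^ m) * (\<integral>\<^sup>+y\<in>T. ennreal (\<bar>f y\<bar> powr p) \<partial>lebesgue)"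
      unfolding divide_ennreal_def using inv by (subst mult.commute) (intro mult_mono, auto)
  qed (use \<open>p \<ge> 1\<close> in auto)
  finally show ?thesis .
qed

text \<open>For fixed \<open>r\<close>, the infimum over the finitely many \<open>J\<close> and the
  two signs is attained; the minimum over all faces is at most the average over the one face
  belonging to that \<open>J\<close> and that sign.\<close>

lemma skeleton_maximal_le_grid_maximal:
  fixes x :: "real^'n::finite" and f :: "real^'n \<Rightarrow> real"
  assumes f: "f \<in> borel_measurable lebesgue" and "p \<ge> 1" and k: "k < CARD('n)"
    and \<delta>: "0 < \<delta>" "\<delta> < 1" and N: "N \<ge> 1" "real N * \<delta> \<le> 2" "1 \<le> real N * \<delta>"
  shows "skeleton_maximal k \<delta> f x \<le> 2 * ennreal_powr (ennreal (real N ^ (CARD('n) - k)) *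
    grid_maximal (CARD('n) - k) N (\<lambda>y. ennreal (\<bar>f y\<bar> powr p)) (grid_cell 1 x) (grid_cell N x)) (1 / p)"
  unfolding skeleton_maximal_def
proof (rule SUP_least)
  fix r :: real assume r: "r \<in> {1..2}"
  let ?m = "CARD('n) - k" and ?\<phi> = "\<lambda>y. ennreal (\<bar>f y\<bar> powr p)"
  let ?w = "grid_cell 1 x" and ?c = "grid_cell N x"
  define \<rho> where "\<rho> = \<lfloor>real N * r\<rfloor>"
  define g where "g J = min (slab_mass N ?\<phi> ?w J (\<lambda>i. ?c i + \<rho>)) (slab_mass N ?\<phi> ?w J (\<lambda>i. ?c i - \<rho>))" for J
  have "real N * 1 \<le> real N * r" "real N * r \<le> real N * 2"
    using r by (intro mult_left_mono; simp)+
  then have \<rho>: "\<rho> \<in> {int N..2 * int N}" unfolding \<rho>_def by (auto simp: le_floor_iff floor_le_iff)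
  have "finite (g ` {J. card J = ?m})" "g ` {J. card J = ?m} \<noteq> {}"
    using obtain_subset_with_card_n[of ?m "UNIV :: 'n set"] by auto
  then have "Min (g ` {J. card J = ?m}) \<in> g ` {J. card J = ?m}" by (rule Min_in)
  moreover have "Min (g ` {J. card J = ?m}) = (INF J\<in>{J. card J = ?m}. g J)"
    using \<open>finite (g ` _)\<close> \<open>g ` _ \<noteq> {}\<close> by (rule Min_Inf)
  ultimately obtain J where J: "card J = ?m" "(INF J\<in>{J. card J = ?m}. g J) = g J" by auto
  have "(INF J\<in>{J. card J = ?m}. g J) \<le> grid_maximal ?m N ?\<phi> ?w ?c"
    unfolding grid_maximal_def g_def by (rule SUP_upper[OF \<rho>])
  then have "g J \<le> grid_maximal ?m N ?\<phi> ?w ?c" using J(2) by simp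
  moreover obtain b where b: "slab_mass N ?\<phi> ?w J (\<lambda>i. ?c i + (if b then \<rho> else - \<rho>)) = g J"
  proof (cases "slab_mass N ?\<phi> ?w J (\<lambda>i. ?c i + \<rho>) \<le> slab_mass N ?\<phi> ?w J (\<lambda>i. ?c i - \<rho>)")
    case True
    then show ?thesis by (intro that[of True]) (simp add: g_def)
  next
    case False
    then show ?thesis by (intro that[of False]) (simp add: g_def)
  qed
  ultimately have mass: "(\<integral>\<^sup>+y\<in>local_slab N ?w J (\<lambda>i. ?c i + (if b then \<rho> else - \<rho>)). ?\<phi> y \<partial>lebesgue)
      \<le> grid_maximal ?m N ?\<phi> ?w ?c"
    by (simp add: slab_mass_def)
  let ?P = "if b then UNIV else {} :: 'n set"
  have cJ: "card (- J) = k" using J k by (simp add: Compl_eq_Diff_UNIV card_Diff_subset)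
  \<comment> \<open>\<open>k_faces\<close> asks for index sets within the fixed directions, here
    \<open>J\<close>; elements of \<open>?P\<close> outside \<open>J\<close> do not change the
    face.\<close>
  have face: "cube_face x r (- J) ?P = cube_face x r (- J) (?P \<inter> J)"
    by (auto simp: cube_face_def)
  then have "cube_face x r (- J) ?P \<in> k_faces k x r"
    unfolding k_faces_def using cJ by auto
  then have "Min ((\<lambda>F. abs_average (inf_nbhd \<delta> F) f) ` k_faces k x r)
      \<le> abs_average (inf_nbhd \<delta> (cube_face x r (- J) ?P)) f"
    by (intro Min_le finite_imageI finite_k_faces imageI)
  also have "\<dots> \<le> 2 * ennreal_powr (ennreal (real N ^ ?m) *
      (\<integral>\<^sup>+y\<in>local_slab N ?w J (\<lambda>i. ?c i + (if b then \<rho> else - \<rho>)). ?\<phi> y \<partial>lebesgue)) (1 / p)"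
    using inf_nbhd_cube_face_subset_local_slab[OF r \<delta> N(1,2) \<rho>_def, of x "- J" b] J
    by (intro abs_average_cube_face_le[OF f \<open>p \<ge> 1\<close> r \<delta> N]) simp_all
  also have "\<dots> \<le> 2 * ennreal_powr (ennreal (real N ^ ?m) * grid_maximal ?m N ?\<phi> ?w ?c) (1 / p)"
    using mass \<open>p \<ge> 1\<close> by (intro mult_left_mono ennreal_powr_mono) auto
  finally show "Min ((\<lambda>F. abs_average (inf_nbhd \<delta> F) f) ` k_faces k x r) \<le> \<dots>" .
qed

section \<open>Summation over cells and unit cubes\<close>

lemma slab_mass_coord_proj: "slab_mass N \<phi> w J (coord_proj J z) = slab_mass N \<phi> w J z"
  by (simp add: slab_mass_def local_slab_def coord_proj_def)

text \<open>Bounded overlap: for given \<open>y\<close> the tolerance 3 leaves seven values of each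
  coordinate \<open>z i\<close> with i in \<open>J\<close>, and the other coordinates of a projected
  point are 0, so at most 7^n slabs contain \<open>y\<close>.\<close>

lemma sum_slab_mass_le:
  fixes \<phi> :: "real^'n::finite \<Rightarrow> ennreal" and Z :: "('n \<Rightarrow> int) set"
  assumes [measurable]: "\<phi> \<in> borel_measurable lebesgue" and "finite Z" and Z: "coord_proj J ` Z \<subseteq> Z"
  shows "(\<Sum>z\<in>coord_proj J ` Z. slab_mass N \<phi> w J z)
    \<le> ennreal (7 ^ CARD('n)) * (\<integral>\<^sup>+y\<in>local_slab N w {} w. \<phi> y \<partial>lebesgue)"
proof -
  let ?Z = "coord_proj J ` Z"
  have slab: "local_slab N w J z \<in> sets lebesgue" for J z :: _
    using sets_local_slab[of N w J z] by simp
  have "(\<Sum>z\<in>?Z. slab_mass N \<phi> w J z)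
    = (\<integral>\<^sup>+y. (\<Sum>z\<in>?Z. \<phi> y * indicator (local_slab N w J z) y) \<partial>lebesgue)"
    unfolding slab_mass_def using slab
    by (intro nn_integral_sum[symmetric] borel_measurable_times_ennreal borel_measurable_indicator) auto
  also have "\<dots> \<le> (\<integral>\<^sup>+y. ennreal (7 ^ CARD('n)) * (\<phi> y * indicator (local_slab N w {} w) y) \<partial>lebesgue)"
  proof (rule nn_integral_mono)
    fix y :: "real^'n"
    let ?A = "{z\<in>?Z. y \<in> local_slab N w J z}"
    let ?B = "PiE UNIV (\<lambda>i. {grid_cell N y i - 3..grid_cell N y i + 3})"
    have "?A \<subseteq> coord_proj J ` ?B"
    proof
      fix z assume z: "z \<in> ?A"
      define z' where "z' = (\<lambda>i. if i \<in> J then z i else grid_cell N y i)"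
      have near: "\<bar>grid_cell N y i - z i\<bar> \<le> 3" if "i \<in> J" for i
        using z that by (simp add: local_slab_def)
      have "z' i \<in> {grid_cell N y i - 3..grid_cell N y i + 3}" for i
        using near[of i] by (auto simp: z'_def abs_le_iff)
      then have "z' \<in> ?B" by auto
      moreover have "z = coord_proj J z'"
        using z by (auto simp: coord_proj_def z'_def fun_eq_iff)
      ultimately show "z \<in> coord_proj J ` ?B" by blast
    qed
    moreover have "finite ?B" by (intro finite_PiE) auto
    ultimately have "card ?A \<le> card ?B"
      by (meson card_image_le card_mono finite_imageI order_trans)
    then have card: "card ?A \<le> 7 ^ CARD('n)" by (simp add: card_PiE)
    have "(\<Sum>z\<in>?Z. \<phi> y * indicator (local_slab N w J z) y) = (\<Sum>z\<in>?A. \<phi> y)"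
      using \<open>finite Z\<close> by (intro sum.mono_neutral_cong_right) (auto simp: indicator_def)
    also have "\<dots> = of_nat (card ?A) * \<phi> y" by simp
    also have "\<dots> \<le> ennreal (7 ^ CARD('n)) * \<phi> y"
    proof (rule mult_right_mono)
      have "(of_nat (card ?A) :: ennreal) \<le> of_nat (7 ^ CARD('n))" using card by (rule of_nat_mono)
      then show "of_nat (card ?A) \<le> ennreal (7 ^ CARD('n))"
        by (simp flip: ennreal_power)
    qed simp
    finally have le: "(\<Sum>z\<in>?Z. \<phi> y * indicator (local_slab N w J z) y) \<le> ennreal (7 ^ CARD('n)) * \<phi> y" .
    show "(\<Sum>z\<in>?Z. \<phi> y * indicator (local_slab N w J z) y)
      \<le> ennreal (7 ^ CARD('n)) * (\<phi> y * indicator (local_slab N w {} w) y)"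
    proof (cases "y \<in> local_slab N w {} w")
      case True
      then show ?thesis using le by simp
    next
      case False
      then have "y \<notin> local_slab N w J z" for z by (auto simp: local_slab_def)
      then show ?thesis by simp
    qed
  qed
  also have "\<dots> = ennreal (7 ^ CARD('n)) * (\<integral>\<^sup>+y\<in>local_slab N w {} w. \<phi> y \<partial>lebesgue)"
    using slab by (intro nn_integral_cmult borel_measurable_times_ennreal borel_measurable_indicator) auto
  finally show ?thesis .
qed

text \<open>
  Layer cake: the counting estimate is integrated over the levels. It applies to each level
  because the maximal function is built from minima.
\<close>
lemma sum_grid_maximal_le:
  fixes \<phi> :: "real^'n::finite \<Rightarrow> ennreal" and w :: "'n \<Rightarrow> int"
  assumes \<phi>: "\<phi> \<in> borel_measurable lebesgue" and m: "1 \<le> m" "m \<le> CARD('n)" and N: "N \<ge> 1"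
    and W: "W = PiE UNIV (\<lambda>i. {int N * w i..<int N * w i + int N})"
  shows "(\<Sum>c\<in>W. grid_maximal m N \<phi> w c) \<le>
    ennreal ((28 * real CARD('n)) ^ CARD('n) * (real N powr (real m / (2 * real CARD('n))) * real N ^ (CARD('n) - m)))
      * (\<integral>\<^sup>+y\<in>local_slab N w {} w. \<phi> y \<partial>lebesgue)"
proof -
  let ?n = "CARD('n)" and ?H = "grid_maximal m N \<phi> w" and ?G = "slab_mass N \<phi> w"
  let ?JJ = "{J::'n set. card J = m}"
  \<comment> \<open>The ranges of \<open>c\<close> and \<open>\<rho>\<close> place both vertices in
    these intervals; the additional 0 makes \<open>Z\<close> closed under
    \<open>coord_proj\<close>.\<close>
  define Z where "Z = PiE (UNIV::'n set) (\<lambda>i. insert 0 {int N * w i - 2 * int N..int N * w i + 3 * int N})"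
  define D where "D = (2 * real ?n) ^ ?n * (real N powr (real m / (2 * real ?n)) * real N ^ (?n - m))"
  have D0: "D \<ge> 0" by (simp add: D_def)
  have finZ: "finite Z" unfolding Z_def by (intro finite_PiE) auto
  have finW: "finite W" unfolding W by (intro finite_PiE) auto
  have ZZ: "coord_proj J ` Z \<subseteq> Z" for J
  proof clarify
    fix z assume "z \<in> Z"
    then have z: "z i \<in> insert 0 {int N * w i - 2 * int N..int N * w i + 3 * int N}" for i
      unfolding Z_def by blast
    have "coord_proj J z i \<in> insert 0 {int N * w i - 2 * int N..int N * w i + 3 * int N}" for i
      using z[of i] by (cases "i \<in> J") (simp_all add: coord_proj_def)
    then show "coord_proj J z \<in> Z" unfolding Z_def by blast
  qed
  define L where "L X = {t::real. 0 \<le> t \<and> ennreal t < X}" for X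
  have L [measurable]: "L X \<in> sets borel" for X
    unfolding L_def by measurable
  define E where "E t J = {z\<in>coord_proj J ` Z. t \<in> L (?G J z)}" for t J
  have count: "real (card {c\<in>W. t \<in> L (?H c)}) \<le> D * (\<Sum>J\<in>?JJ. real (card (E t J)))" for t
  proof (cases "{c\<in>W. t \<in> L (?H c)} = {}")
    case True
    have "0 \<le> D * (\<Sum>J\<in>?JJ. real (card (E t J)))" using D0 by (simp add: sum_nonneg)
    then show ?thesis unfolding True by simp
  next
    case False
    \<comment> \<open>The sum over \<open>J\<close> bounds every \<open>card (E t J)\<close> at
      once, and it can be integrated over \<open>t\<close> term by term.\<close>
    define e where "e = (\<Sum>J\<in>?JJ. real (card (E t J)))"
    have vert: "\<exists>\<rho>. \<forall>J. card J = m \<longrightarrow>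
        coord_proj J (\<lambda>i. c i + \<rho>) \<in> E t J \<and> coord_proj J (\<lambda>i. c i - \<rho>) \<in> E t J"
      if c: "c \<in> {c\<in>W. t \<in> L (?H c)}" for c
    proof -
      have t: "0 \<le> t" "ennreal t < ?H c" using c by (auto simp: L_def)
      then obtain \<rho> where \<rho>: "\<rho> \<in> {int N..2 * int N}"
        and inf: "ennreal t < (INF J\<in>?JJ. min (?G J (\<lambda>i. c i + \<rho>)) (?G J (\<lambda>i. c i - \<rho>)))"
        unfolding grid_maximal_def less_SUP_iff by blast
      have range: "c i \<in> {int N * w i..<int N * w i + int N}" for i
        using c unfolding W by (auto simp: PiE_iff)
      have "(\<lambda>i. c i + \<rho>) \<in> Z" "(\<lambda>i. c i - \<rho>) \<in> Z"
        unfolding Z_def using range \<rho> by (auto simp: PiE_iff) (smt (verit))+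
      moreover have "ennreal t < ?G J (\<lambda>i. c i + \<rho>)" "ennreal t < ?G J (\<lambda>i. c i - \<rho>)" if "card J = m" for J
      proof -
        have "ennreal t < min (?G J (\<lambda>i. c i + \<rho>)) (?G J (\<lambda>i. c i - \<rho>))"
          using inf by (rule less_le_trans[OF _ INF_lower]) (use that in simp)
        then show "ennreal t < ?G J (\<lambda>i. c i + \<rho>)" "ennreal t < ?G J (\<lambda>i. c i - \<rho>)" by simp_all
      qed
      ultimately show ?thesis
        using t by (intro exI[of _ \<rho>]) (simp add: E_def L_def slab_mass_coord_proj)
    qed
    have finE: "finite (E t J)" for J using finZ by (simp add: E_def)
    have cardE: "real (card (E t J)) \<le> e" if "card J = m" for J
      unfolding e_def using that by (intro member_le_sum) auto
    have "e > 0"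
    proof -
      obtain c where "c \<in> {c\<in>W. t \<in> L (?H c)}" using False by blast
      then obtain \<rho> where "\<forall>J. card J = m \<longrightarrow> coord_proj J (\<lambda>i. c i + \<rho>) \<in> E t J" using vert by blast
      moreover obtain J :: "'n set" where J: "card J = m"
        using obtain_subset_with_card_n[of m "UNIV :: 'n set"] m by auto
      ultimately have "card (E t J) > 0" using finE by (auto simp: card_gt_0_iff)
      then show ?thesis using cardE[OF J] by simp
    qed
    have "real (card {c\<in>W. t \<in> L (?H c)}) \<le> (2 * real ?n) ^ ?n *
        (real N powr (real m / (2 * real ?n)) * real N ^ (?n - m) * e)"
    proof (rule card_skeleton_centres_le[OF m N \<open>e > 0\<close> _ finE cardE vert])
      fix c i assume "c \<in> {c\<in>W. t \<in> L (?H c)}"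
      then show "c i \<in> {int N * w i..<int N * w i + int N}" unfolding W by (auto simp: PiE_iff)
    qed
    then show ?thesis by (simp add: D_def e_def mult_ac)
  qed
  have card_sum: "ennreal (real (card {x\<in>A. P x})) = (\<Sum>x\<in>A. indicator {x. P x} x)" if "finite A" for A and P :: "'b \<Rightarrow> bool"
    using that by (simp add: indicator_def sum.If_cases Int_def ennreal_of_nat_eq_real_of_nat)
  have "(\<Sum>c\<in>W. ?H c) = (\<Sum>c\<in>W. \<integral>\<^sup>+t. indicator (L (?H c)) t \<partial>lborel)"
    using L by (simp add: emeasure_superlevel_ennreal L_def)
  also have "\<dots> = (\<integral>\<^sup>+t. (\<Sum>c\<in>W. indicator (L (?H c)) t) \<partial>lborel)"
    by (rule nn_integral_sum[symmetric]) simp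
  also have "\<dots> \<le> (\<integral>\<^sup>+t. ennreal D * (\<Sum>J\<in>?JJ. \<Sum>z\<in>coord_proj J ` Z. indicator (L (?G J z)) t) \<partial>lborel)"
  proof (rule nn_integral_mono)
    fix t :: real
    have ind: "(\<Sum>c\<in>A. indicator (L (h c)) t) = ennreal (real (card {c\<in>A. t \<in> L (h c)}))"
      if "finite A" for A :: "('n \<Rightarrow> int) set" and h
      unfolding card_sum[OF that] by (simp add: indicator_def)
    have "(\<Sum>c\<in>W. indicator (L (?H c)) t) = ennreal (real (card {c\<in>W. t \<in> L (?H c)}))"
      by (rule ind[OF finW])
    also have "\<dots> \<le> ennreal (D * (\<Sum>J\<in>?JJ. real (card (E t J))))"
      by (rule ennreal_leI[OF count])
    also have "\<dots> = ennreal D * (\<Sum>J\<in>?JJ. ennreal (real (card (E t J))))"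
      using D0 by (subst sum_ennreal) (auto intro!: ennreal_mult sum_nonneg)
    also have "\<dots> = ennreal D * (\<Sum>J\<in>?JJ. \<Sum>z\<in>coord_proj J ` Z. indicator (L (?G J z)) t)"
      unfolding E_def using finZ by (subst ind) auto
    finally show "(\<Sum>c\<in>W. indicator (L (?H c)) t)
      \<le> ennreal D * (\<Sum>J\<in>?JJ. \<Sum>z\<in>coord_proj J ` Z. indicator (L (?G J z)) t)" .
  qed
  also have "\<dots> = ennreal D * (\<Sum>J\<in>?JJ. \<Sum>z\<in>coord_proj J ` Z. ?G J z)"
    using L by (simp add: nn_integral_cmult nn_integral_sum emeasure_superlevel_ennreal[folded L_def])
  also have "\<dots> \<le> ennreal D * (\<Sum>J\<in>?JJ. ennreal (7 ^ ?n) * (\<integral>\<^sup>+y\<in>local_slab N w {} w. \<phi> y \<partial>lebesgue))"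
    by (intro mult_left_mono sum_mono sum_slab_mass_le[OF \<phi> finZ ZZ]) simp
  also have "\<dots> = ennreal D * (of_nat (card ?JJ) * (ennreal (7 ^ ?n) * (\<integral>\<^sup>+y\<in>local_slab N w {} w. \<phi> y \<partial>lebesgue)))"
    by simp
  also have "\<dots> \<le> ennreal D * (ennreal (2 ^ ?n) * (ennreal (7 ^ ?n) * (\<integral>\<^sup>+y\<in>local_slab N w {} w. \<phi> y \<partial>lebesgue)))"
  proof (intro mult_left_mono mult_right_mono)
    have "card ?JJ \<le> card (Pow (UNIV :: 'n set))"
      by (intro card_mono) auto
    then have "(of_nat (card ?JJ) :: ennreal) \<le> of_nat (2 ^ ?n)" by (intro of_nat_mono) (simp add: card_Pow)
    then show "of_nat (card ?JJ) \<le> ennreal (2 ^ ?n)" by (simp flip: ennreal_power)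
  qed simp_all
  also have "\<dots> = ennreal (D * (2 ^ ?n * 7 ^ ?n)) * (\<integral>\<^sup>+y\<in>local_slab N w {} w. \<phi> y \<partial>lebesgue)"
    using D0 by (simp add: ennreal_mult mult.assoc)
  \<comment> \<open>28 = 2 * 2 * 7: from the counting estimate, the number of sets \<open>J\<close>,
    and the overlap of the slabs.\<close>
  also have "D * (2 ^ ?n * 7 ^ ?n) = (28 * real ?n) ^ ?n * (real N powr (real m / (2 * real ?n)) * real N ^ (?n - m))"
  proof -
    have "28 * real ?n = 2 * real ?n * (2 * 7)" by simp
    then have "(28 * real ?n) ^ ?n = (2 * real ?n) ^ ?n * (2 ^ ?n * 7 ^ ?n)"
      by (simp only: power_mult_distrib)
    then show ?thesis by (simp only: D_def mult_ac)
  qed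
  finally show ?thesis .
qed

text \<open>Centres are grouped by their unit cube \<open>w\<close>, which confines their cells to
  ranges of length \<open>N\<close> as the counting demands. The enlarged cubes
  \<open>local_slab N w {} w\<close> cover each point 7^n times, so the local estimates add up to a
  global one.\<close>

lemma nn_integral_grid_maximal_le:
  fixes \<phi> :: "real^'n::finite \<Rightarrow> ennreal"
  assumes \<phi>: "\<phi> \<in> borel_measurable lebesgue" and m: "1 \<le> m" "m \<le> CARD('n)" and N: "N \<ge> 1"
  shows "ennreal (real N ^ m) * (\<integral>\<^sup>+x. grid_maximal m N \<phi> (grid_cell 1 x) (grid_cell N x) \<partial>lebesgue) \<le>
    ennreal ((196 * real CARD('n)) ^ CARD('n) * real N powr (real m / (2 * real CARD('n)))) * (\<integral>\<^sup>+y. \<phi> y \<partial>lebesgue)"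
proof -
  let ?n = "CARD('n)" and ?C = "count_space (UNIV :: ('n \<Rightarrow> int) set)"
  define W where "W w = PiE (UNIV::'n set) (\<lambda>i. {int N * w i..<int N * w i + int N})" for w
  have finW: "finite (W w)" for w unfolding W_def by (intro finite_PiE) auto
  define D where "D = (28 * real ?n) ^ ?n * (real N powr (real m / (2 * real ?n)) * real N ^ (?n - m))"
  have D0: "D \<ge> 0" by (simp add: D_def)
  define g where "g w x = (\<Sum>c\<in>W w. grid_maximal m N \<phi> w c * indicator {x. grid_cell N x = c} x)"
    for w and x :: "real^'n"
  have cell: "{x. grid_cell N x = c} \<in> sets (borel :: (real^'n) measure)" for c
  proof -
    have "grid_cell N -` {c} \<inter> space (borel :: (real^'n) measure) \<in> sets borel"
      by (rule measurable_sets[OF grid_cell_measurable]) simp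
    then show ?thesis by (simp add: vimage_def)
  qed
  then have cell': "{x. grid_cell N x = c} \<in> sets (lebesgue :: (real^'n) measure)" for c by simp
  have g: "g w \<in> borel_measurable lebesgue" for w
    unfolding g_def
    by (intro borel_measurable_sum borel_measurable_times_ennreal borel_measurable_const borel_measurable_indicator cell')
  have "(\<integral>\<^sup>+x. grid_maximal m N \<phi> (grid_cell 1 x) (grid_cell N x) \<partial>lebesgue) \<le> (\<integral>\<^sup>+x. (\<integral>\<^sup>+w. g w x \<partial>?C) \<partial>lebesgue)"
  proof (rule nn_integral_mono)
    fix x :: "real^'n"
    have "grid_cell N x i \<in> {int N * grid_cell 1 x i..<int N * grid_cell 1 x i + int N}" for i
    proof -
      have "real N * of_int \<lfloor>x $ i\<rfloor> \<le> real N * x $ i" "real N * x $ i < real N * (of_int \<lfloor>x $ i\<rfloor> + 1)"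
        using N by (auto intro!: mult_left_mono mult_strict_left_mono)
      then show ?thesis
        by (simp add: grid_cell_def le_floor_iff floor_less_iff algebra_simps)
    qed
    then have "grid_cell N x \<in> W (grid_cell 1 x)" by (auto simp: W_def)
    then have "grid_maximal m N \<phi> (grid_cell 1 x) (grid_cell N x) * indicator {x'. grid_cell N x' = grid_cell N x} x
        \<le> g (grid_cell 1 x) x"
      unfolding g_def using finW
      by (intro member_le_sum[where f = "\<lambda>c. grid_maximal m N \<phi> (grid_cell 1 x) c * indicator {x. grid_cell N x = c} x"]) auto
    also have "\<dots> \<le> (\<integral>\<^sup>+w. g w x \<partial>?C)" by (rule nn_integral_ge_point) simp
    finally show "grid_maximal m N \<phi> (grid_cell 1 x) (grid_cell N x) \<le> (\<integral>\<^sup>+w. g w x \<partial>?C)" by simp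
  qed
  also have "\<dots> = (\<integral>\<^sup>+w. (\<integral>\<^sup>+x. g w x \<partial>lebesgue) \<partial>?C)"
    using g by (intro nn_integral_count_space_nn_integral) auto
  also have "\<dots> \<le> (\<integral>\<^sup>+w. (\<integral>\<^sup>+y. ennreal (D * (1 / real N) ^ ?n) * (\<phi> y * indicator (local_slab N w {} w) y) \<partial>lebesgue) \<partial>?C)"
  proof (rule nn_integral_mono)
    fix w :: "'n \<Rightarrow> int"
    have "(\<integral>\<^sup>+x. g w x \<partial>lebesgue)
      = (\<Sum>c\<in>W w. \<integral>\<^sup>+x. grid_maximal m N \<phi> w c * indicator {x. grid_cell N x = c} x \<partial>lebesgue)"
      unfolding g_def
      by (intro nn_integral_sum borel_measurable_times_ennreal borel_measurable_const borel_measurable_indicator cell')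
    also have "\<dots> = (\<Sum>c\<in>W w. grid_maximal m N \<phi> w c * emeasure lebesgue {x. grid_cell N x = c})"
      by (intro sum.cong refl nn_integral_cmult_indicator cell')
    also have "\<dots> = (\<Sum>c\<in>W w. grid_maximal m N \<phi> w c) * ennreal ((1 / real N) ^ ?n)"
      unfolding emeasure_grid_cell[OF N] by (rule sum_distrib_right[symmetric])
    also have "\<dots> \<le> ennreal D * (\<integral>\<^sup>+y\<in>local_slab N w {} w. \<phi> y \<partial>lebesgue) * ennreal ((1 / real N) ^ ?n)"
      using sum_grid_maximal_le[OF \<phi> m N W_def] by (intro mult_right_mono) (auto simp: D_def)
    also have "\<dots> = ennreal (D * (1 / real N) ^ ?n) * (\<integral>\<^sup>+y\<in>local_slab N w {} w. \<phi> y \<partial>lebesgue)"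
      using D0 by (simp add: ennreal_mult mult_ac)
    also have "\<dots> = (\<integral>\<^sup>+y. ennreal (D * (1 / real N) ^ ?n) * (\<phi> y * indicator (local_slab N w {} w) y) \<partial>lebesgue)"
      using sets_local_slab[of N w "{}" w] \<phi>
      by (intro nn_integral_cmult[symmetric] borel_measurable_times_ennreal borel_measurable_indicator) auto
    finally show "(\<integral>\<^sup>+x. g w x \<partial>lebesgue)
        \<le> (\<integral>\<^sup>+y. ennreal (D * (1 / real N) ^ ?n) * (\<phi> y * indicator (local_slab N w {} w) y) \<partial>lebesgue)" .
  qed
  also have "\<dots> = (\<integral>\<^sup>+y. (\<integral>\<^sup>+w. ennreal (D * (1 / real N) ^ ?n) * (\<phi> y * indicator (local_slab N w {} w) y) \<partial>?C) \<partial>lebesgue)"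
    using sets_local_slab \<phi>
    by (intro nn_integral_count_space_nn_integral[symmetric] borel_measurable_times_ennreal borel_measurable_indicator) auto
  also have "\<dots> = (\<integral>\<^sup>+y. ennreal (D * (1 / real N) ^ ?n * 7 ^ ?n) * \<phi> y \<partial>lebesgue)"
  proof (rule nn_integral_cong)
    fix y :: "real^'n"
    let ?B = "PiE UNIV (\<lambda>i. {grid_cell 1 y i - 3..grid_cell 1 y i + 3})"
    have finB: "finite ?B" by (intro finite_PiE) auto
    have mem: "y \<in> local_slab N w {} w \<longleftrightarrow> w \<in> ?B" for w
      by (auto simp: local_slab_def PiE_iff abs_le_iff) (smt (verit))+
    have "(\<integral>\<^sup>+w. ennreal (D * (1 / real N) ^ ?n) * (\<phi> y * indicator (local_slab N w {} w) y) \<partial>?C)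
      = (\<Sum>w\<in>?B. ennreal (D * (1 / real N) ^ ?n) * (\<phi> y * indicator (local_slab N w {} w) y))"
      using finB mem by (intro nn_integral_count_space') auto
    also have "\<dots> = (\<Sum>w\<in>?B. ennreal (D * (1 / real N) ^ ?n) * \<phi> y)"
      using mem by (intro sum.cong) auto
    also have "\<dots> = ennreal (7 ^ ?n) * (ennreal (D * (1 / real N) ^ ?n) * \<phi> y)"
      by (simp add: card_PiE flip: ennreal_power)
    also have "\<dots> = ennreal (D * (1 / real N) ^ ?n * 7 ^ ?n) * \<phi> y"
      using D0 by (simp add: ennreal_mult mult_ac)
    finally show "(\<integral>\<^sup>+w. ennreal (D * (1 / real N) ^ ?n) * (\<phi> y * indicator (local_slab N w {} w) y) \<partial>?C)
      = ennreal (D * (1 / real N) ^ ?n * 7 ^ ?n) * \<phi> y" .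
  qed
  also have "\<dots> = ennreal (D * (1 / real N) ^ ?n * 7 ^ ?n) * (\<integral>\<^sup>+y. \<phi> y \<partial>lebesgue)"
    using \<phi> by (rule nn_integral_cmult)
  finally have "ennreal (real N ^ m) * (\<integral>\<^sup>+x. grid_maximal m N \<phi> (grid_cell 1 x) (grid_cell N x) \<partial>lebesgue)
     \<le> ennreal (real N ^ m) * (ennreal (D * (1 / real N) ^ ?n * 7 ^ ?n) * (\<integral>\<^sup>+y. \<phi> y \<partial>lebesgue))"
    by (rule mult_left_mono) simp
  also have "\<dots> = ennreal (real N ^ m * (D * (1 / real N) ^ ?n * 7 ^ ?n)) * (\<integral>\<^sup>+y. \<phi> y \<partial>lebesgue)"
    using D0 by (simp add: ennreal_mult mult_ac)
  \<comment> \<open>\<open>N ^ m\<close> from the averages, \<open>N ^ (n - m)\<close> from the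
    counting and N^-n from the volume of a cell cancel. The constant is 196 = 28 * 7, the last
    factor being the overlap of the enlarged cubes.\<close>
  also have "real N ^ m * (D * (1 / real N) ^ ?n * 7 ^ ?n) = (196 * real ?n) ^ ?n * real N powr (real m / (2 * real ?n))"
  proof -
    have "real N ^ m * real N ^ (?n - m) = real N ^ ?n" using m by (simp flip: power_add)
    then have "real N ^ m * real N ^ (?n - m) * (1 / real N) ^ ?n = real N ^ ?n * (1 / real N) ^ ?n"
      by (rule arg_cong)
    also have "\<dots> = 1" using N by (simp flip: power_mult_distrib)
    finally have e1: "real N ^ m * real N ^ (?n - m) * (1 / real N) ^ ?n = 1" .
    have "196 * real ?n = 28 * real ?n * 7" by simp
    then have e2: "(28 * real ?n) ^ ?n * 7 ^ ?n = (196 * real ?n) ^ ?n"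
      by (simp only: power_mult_distrib)
    have "real N ^ m * (D * (1 / real N) ^ ?n * 7 ^ ?n)
      = ((28 * real ?n) ^ ?n * 7 ^ ?n) * real N powr (real m / (2 * real ?n)) * (real N ^ m * real N ^ (?n - m) * (1 / real N) ^ ?n)"
      by (simp only: D_def mult_ac)
    then show ?thesis by (simp only: e1 e2 mult_1_right)
  qed
  finally show ?thesis .
qed

section \<open>The norm estimate for all p\<close>

lemma Lp_norm_skeleton_maximal_le:
  fixes f :: "real^'n::finite \<Rightarrow> real"
  assumes k: "k < CARD('n)" and f: "f \<in> borel_measurable lebesgue" and "p \<ge> 1" and \<delta>: "0 < \<delta>" "\<delta> < 1"
  shows "Lp_norm p (skeleton_maximal k \<delta> f) \<le>
    ennreal (4 * (196 * real CARD('n)) ^ CARD('n) * \<delta> powr ((real k - real CARD('n)) / (2 * real CARD('n) * p)))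
      * Lp_norm_real p f"
proof -
  let ?n = "CARD('n)"
  define m where "m = ?n - k"
  have m: "1 \<le> m" "m \<le> ?n" using k by (auto simp: m_def)
  have n1: "real ?n \<ge> 1" using zero_less_card_finite[where 'a = 'n] by linarith
  \<comment> \<open>With this choice 1 / N \<le> \<delta> \<le> 2 / N, so widths and mesh are
    comparable.\<close>
  define N where "N = nat \<lceil>1 / \<delta>\<rceil>"
  have "1 / \<delta> > 1" using \<delta> by simp
  then have N1: "1 / \<delta> \<le> real N" "real N < 1 / \<delta> + 1" by (simp_all add: N_def) linarith+
  have N: "N \<ge> 1" "real N * \<delta> \<le> 2" "1 \<le> real N * \<delta>"
  proof -
    have "1 / \<delta> * \<delta> \<le> real N * \<delta>" using N1 \<delta> by (intro mult_right_mono) auto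
    then show "1 \<le> real N * \<delta>" using \<delta> by simp
    have "real N * \<delta> \<le> (1 / \<delta> + 1) * \<delta>" using N1 \<delta> by (intro mult_right_mono) auto
    also have "\<dots> = 1 + \<delta>" using \<delta> by (simp add: field_simps)
    finally show "real N * \<delta> \<le> 2" using \<delta> by simp
    have "real N > 0" using N1 \<open>1 / \<delta> > 1\<close> by linarith
    then show "N \<ge> 1" by simp
  qed
  have p: "p > 0" using \<open>p \<ge> 1\<close> by simp
  define \<phi> where "\<phi> y = ennreal (\<bar>f y\<bar> powr p)" for y
  have \<phi>: "\<phi> \<in> borel_measurable lebesgue" unfolding \<phi>_def using f by measurable
  define H where "H x = grid_maximal m N \<phi> (grid_cell 1 x) (grid_cell N x)" for x
  define u where "u = real m / (2 * real ?n)"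
  have u: "0 \<le> u" "u \<le> 1" using m n1 by (auto simp: u_def field_simps)
  define L where "L = (196 * real ?n) ^ ?n"
  have L: "L \<ge> 1" unfolding L_def using n1 by (intro one_le_power) linarith
  have pt: "ennreal_powr (skeleton_maximal k \<delta> f x) p \<le> ennreal (2 powr p) * (ennreal (real N ^ m) * H x)" for x
  proof -
    have "ennreal_powr (skeleton_maximal k \<delta> f x) p
      \<le> ennreal_powr (2 * ennreal_powr (ennreal (real N ^ m) * H x) (1 / p)) p"
      using skeleton_maximal_le_grid_maximal[OF f \<open>p \<ge> 1\<close> k \<delta> N, of x] p
      unfolding H_def \<phi>_def m_def by (intro ennreal_powr_mono) auto
    also have "\<dots> = ennreal (2 powr p) * (ennreal (real N ^ m) * H x)"
      using ennreal_powr_mult_ennreal[of 2 _ p] ennreal_powr_powr_inverse[OF p] by simp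
    finally show ?thesis .
  qed
  have "(\<integral>\<^sup>+x. ennreal_powr (skeleton_maximal k \<delta> f x) p \<partial>lebesgue)
      \<le> (\<integral>\<^sup>+x. ennreal (2 powr p) * (ennreal (real N ^ m) * H x) \<partial>lebesgue)"
    by (rule nn_integral_mono) (rule pt)
  also have "\<dots> = ennreal (2 powr p) * (ennreal (real N ^ m) * (\<integral>\<^sup>+x. H x \<partial>lebesgue))"
  proof -
    \<comment> \<open>The maximal function itself was only compared by monotonicity, which
      \<open>nn_integral\<close> has for all functions. Constants are pulled out for
      \<open>H\<close>, which is measurable because it depends on \<open>x\<close> through two cells
      from a countable type.\<close>
    have "(\<lambda>x. grid_maximal m N \<phi> (grid_cell 1 x) (grid_cell N x)) \<in> borel_measurable (borel :: (real^'n) measure)"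
      by (rule measurable_compose_countable'[OF _ grid_cell_measurable]) (simp_all add: measurable_compose[OF grid_cell_measurable])
    then have "H \<in> borel_measurable lebesgue"
      unfolding H_def by (intro measurable_completion) simp
    then show ?thesis by (simp add: nn_integral_cmult)
  qed
  also have "\<dots> \<le> ennreal (2 powr p) * (ennreal (L * real N powr u) * (\<integral>\<^sup>+y. \<phi> y \<partial>lebesgue))"
    using nn_integral_grid_maximal_le[OF \<phi> m N(1)]
    unfolding H_def L_def u_def by (intro mult_left_mono) auto
  also have "\<dots> = ennreal (2 powr p * (L * real N powr u)) * (\<integral>\<^sup>+y. \<phi> y \<partial>lebesgue)"
    using L by (simp add: ennreal_mult mult.assoc)
  also have "\<dots> \<le> ennreal (2 powr p * (2 * L * \<delta> powr (- u))) * (\<integral>\<^sup>+y. \<phi> y \<partial>lebesgue)"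
  proof (intro mult_right_mono ennreal_leI mult_left_mono)
    have "real N \<le> 2 * (1 / \<delta>)" using N1 \<open>1 / \<delta> > 1\<close> by linarith
    then have "real N powr u \<le> (2 * (1 / \<delta>)) powr u" using u by (intro powr_mono2) auto
    also have "\<dots> = 2 powr u * \<delta> powr (- u)" using \<delta> by (simp add: powr_mult powr_divide powr_minus_divide)
    also have "\<dots> \<le> 2 powr 1 * \<delta> powr (- u)" using u by (intro mult_right_mono powr_mono) auto
    finally have "L * real N powr u \<le> L * (2 * \<delta> powr (- u))" using L by (intro mult_left_mono) auto
    then show "L * real N powr u \<le> 2 * L * \<delta> powr (- u)" by (simp add: mult_ac)
  qed auto
  finally have main: "(\<integral>\<^sup>+x. ennreal_powr (skeleton_maximal k \<delta> f x) p \<partial>lebesgue)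
    \<le> ennreal (2 powr p * (2 * L * \<delta> powr (- u))) * (\<integral>\<^sup>+y. \<phi> y \<partial>lebesgue)" .
  have pos: "2 powr p * (2 * L * \<delta> powr (- u)) > 0" using L \<delta> by simp
  have "(\<integral>\<^sup>+y. \<phi> y \<partial>lebesgue) = (\<integral>\<^sup>+y. ennreal_powr (ennreal \<bar>f y\<bar>) p \<partial>lebesgue)"
    by (simp add: \<phi>_def)
  then have norm: "ennreal_powr (\<integral>\<^sup>+y. \<phi> y \<partial>lebesgue) (1 / p) = Lp_norm_real p f"
    by (simp add: Lp_norm_def)
  have "Lp_norm p (skeleton_maximal k \<delta> f)
      \<le> ennreal_powr (ennreal (2 powr p * (2 * L * \<delta> powr (- u))) * (\<integral>\<^sup>+y. \<phi> y \<partial>lebesgue)) (1 / p)"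
    unfolding Lp_norm_def using main p by (intro ennreal_powr_mono) auto
  also have "\<dots> = ennreal ((2 powr p * (2 * L * \<delta> powr (- u))) powr (1 / p)) * Lp_norm_real p f"
    unfolding ennreal_powr_mult_ennreal[OF pos] norm ..
  also have "\<dots> \<le> ennreal (4 * L * \<delta> powr ((real k - real ?n) / (2 * real ?n * p))) * Lp_norm_real p f"
  proof (intro mult_right_mono ennreal_leI)
    have "(2 powr p * (2 * L * \<delta> powr (- u))) powr (1 / p)
      = 2 * (2 * L) powr (1 / p) * \<delta> powr (- u * (1 / p))"
      using p L \<delta> by (simp add: powr_mult powr_powr)
    also have "- u * (1 / p) = (real k - real ?n) / (2 * real ?n * p)"
      using k n1 p by (simp add: u_def m_def field_simps of_nat_diff)
    \<comment> \<open>As \<open>2 * L \<ge> 1\<close>, the root is at most \<open>2 * L\<close>,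
      which makes the constant independent of p.\<close>
    also have "(2 * L) powr (1 / p) \<le> (2 * L) powr 1"
      using L \<open>p \<ge> 1\<close> by (intro powr_mono) auto
    finally show "(2 powr p * (2 * L * \<delta> powr (- u))) powr (1 / p)
      \<le> 4 * L * \<delta> powr ((real k - real ?n) / (2 * real ?n * p))"
      using L by (simp add: mult_right_mono mult_left_mono)
  qed simp
  finally show ?thesis by (simp add: L_def)
qed

lemma Lp_opnorm_skeleton_maximal_le:
  fixes k :: nat
  assumes k: "k < CARD('n::finite)" and "p \<ge> 1" and \<delta>: "0 < \<delta>" "\<delta> < 1"
  shows "Lp_opnorm p (skeleton_maximal k \<delta> :: (real^'n \<Rightarrow> real) \<Rightarrow> real^'n \<Rightarrow> ennreal) \<le>
    ennreal (4 * (196 * real CARD('n)) ^ CARD('n) * \<delta> powr ((real k - real CARD('n)) / (2 * real CARD('n) * p)))"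
  unfolding Lp_opnorm_def
proof (rule SUP_least)
  fix f :: "real^'n \<Rightarrow> real" assume "f \<in> {f \<in> Lp_space p. \<not> (AE x in lebesgue. f x = 0)}"
  then have f: "f \<in> borel_measurable lebesgue" and nz: "\<not> (AE x in lebesgue. f x = 0)"
    by (auto simp: Lp_space_def)
  \<comment> \<open>In [0,\<infinity>] a positive number divided by 0 is infinite, so the quotient
    is controlled only once the denominator is positive.\<close>
  have "Lp_norm_real p f \<noteq> 0"
  proof
    assume "Lp_norm_real p f = 0"
    then have "(\<integral>\<^sup>+y. ennreal (\<bar>f y\<bar> powr p) \<partial>lebesgue) = 0"
      by (auto simp: Lp_norm_def ennreal_powr_def enn2real_eq_0_iff split: if_splits)
    moreover have "(\<lambda>y. ennreal (\<bar>f y\<bar> powr p)) \<in> borel_measurable lebesgue" using f by measurable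
    ultimately have "AE y in lebesgue. ennreal (\<bar>f y\<bar> powr p) = 0" by (simp only: nn_integral_0_iff_AE)
    then have "AE y in lebesgue. f y = 0" by (rule AE_mp) (auto simp: ennreal_eq_0_iff)
    then show False using nz by blast
  qed
  then have "Lp_norm_real p f > 0" by (simp add: zero_less_iff_neq_zero)
  then show "Lp_norm p (skeleton_maximal k \<delta> f) / Lp_norm_real p f \<le>
    ennreal (4 * (196 * real CARD('n)) ^ CARD('n) * \<delta> powr ((real k - real CARD('n)) / (2 * real CARD('n) * p)))"
    using Lp_norm_skeleton_maximal_le[OF k f \<open>p \<ge> 1\<close> \<delta>]
    by (intro divide_le_posI_ennreal) (simp_all add: mult.commute)
qed

section \<open>The lower bound\<close>

text \<open>The condition at \<open>j\<close> says that the digit of \<open>t\<close> at place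
  \<open>j + 1\<close> after the point vanishes modulo \<open>q\<close> up to about \<open>c\<close>
  units. Measuring the distance to the integers from both sides makes it invariant under
  \<open>t \<mapsto> - t\<close> and stable under small shifts.\<close>

definition digit_zero :: "nat \<Rightarrow> nat \<Rightarrow> real \<Rightarrow> real set" where
  "digit_zero q l c = {t. \<exists>j<l. \<exists>z::int. \<bar>real q ^ j * t - of_int z\<bar> < c / real q}"

text \<open>
  The digits of \<open>r\<close> in base \<open>q\<close> are chosen one after the other, the digit number \<open>j + 1\<close> so as
  to make that digit of \<open>s j + r\<close> vanish; the digits chosen later spoil this by at most one unit.
\<close>
lemma exists_common_radius:
  fixes s :: "nat \<Rightarrow> real"
  assumes "q \<ge> 1"
  shows "\<exists>r. 1 \<le> r \<and> r \<le> 2 \<and> (\<forall>j<l. \<exists>z::int. \<bar>real q ^ j * (s j + r) - of_int z\<bar> < 2 / real q)"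
proof -
  let ?q = "real q"
  have q: "?q > 0" using assms by simp
  \<comment> \<open>The slack in both bounds is the budget of the later digits: together they add at
    most \<open>1 / q ^ l\<close> to \<open>r\<close>, hence at most
    \<open>q ^ Suc j / q ^ l\<close> to the scaled number. A freshly chosen digit leaves an error
    below 1, so 2 is enough for all times.\<close>
  have "\<exists>r. 1 \<le> r \<and> r \<le> 2 - 1 / ?q ^ l \<and> (\<forall>j<l. \<exists>z::int. ?q * of_int z \<le> ?q ^ Suc j * (s j + r)
     \<and> ?q ^ Suc j * (s j + r) < ?q * of_int z + 2 - ?q ^ Suc j / ?q ^ l)"
  proof (induction l)
    case 0
    then show ?case by (intro exI[of _ 1]) simp
  next
    case (Suc l)
    then obtain r where r: "1 \<le> r" "r \<le> 2 - 1 / ?q ^ l"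
      and old: "\<And>j. j < l \<Longrightarrow> \<exists>z::int. ?q * of_int z \<le> ?q ^ Suc j * (s j + r)
         \<and> ?q ^ Suc j * (s j + r) < ?q * of_int z + 2 - ?q ^ Suc j / ?q ^ l"
      by blast
    define t where "t = ?q ^ Suc l * (s l + r)"
    \<comment> \<open>The new digit of \<open>r\<close>: adding \<open>d / q ^ Suc l\<close> to
      \<open>r\<close> shifts \<open>t\<close> by \<open>d\<close> and turns its integer part into a
      multiple of \<open>q\<close>.\<close>
    define d where "d = (- \<lfloor>t\<rfloor>) mod int q"
    have d: "0 \<le> d" "d \<le> int q - 1" using assms by (simp_all add: d_def)
    have "real_of_int d \<le> real_of_int (int q - 1)" using d(2) by (simp only: of_int_le_iff)
    then have d': "0 \<le> real_of_int d" "real_of_int d \<le> ?q - 1" using d by simp_all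
    have "(\<lfloor>t\<rfloor> + d) mod int q = 0" unfolding d_def by (simp add: mod_add_right_eq)
    then obtain z0 where z0: "\<lfloor>t\<rfloor> + d = int q * z0" by (metis dvdE mod_0_imp_dvd)
    define r' where "r' = r + of_int d / ?q ^ Suc l"
    have step: "of_int d / ?q ^ Suc l \<le> 1 / ?q ^ l - 1 / ?q ^ Suc l"
      using d' q by (simp add: field_simps)
    have "0 \<le> of_int d / ?q ^ Suc l" using d' q by simp
    then have "1 \<le> r'" using r by (simp add: r'_def)
    moreover have "r' \<le> 2 - 1 / ?q ^ Suc l" using r step by (simp add: r'_def)
    moreover have "\<exists>z::int. ?q * of_int z \<le> ?q ^ Suc j * (s j + r')
       \<and> ?q ^ Suc j * (s j + r') < ?q * of_int z + 2 - ?q ^ Suc j / ?q ^ Suc l" if "j < Suc l" for j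
    proof (cases "j = l")
      case True
      have "?q ^ Suc l * (s l + r') = t + of_int d"
        using q by (simp add: t_def r'_def field_simps)
      moreover have "of_int \<lfloor>t\<rfloor> + of_int d = ?q * of_int z0"
        using z0 by (metis of_int_add of_int_mult of_int_of_nat_eq)
      ultimately have "?q * of_int z0 \<le> ?q ^ Suc l * (s l + r')"
        "?q ^ Suc l * (s l + r') < ?q * of_int z0 + 1" by linarith+
      then show ?thesis using True q by (intro exI[of _ z0]) simp
    next
      case False
      then have "j < l" using that by simp
      from old[OF this] obtain z :: int where z: "?q * of_int z \<le> ?q ^ Suc j * (s j + r)"
         "?q ^ Suc j * (s j + r) < ?q * of_int z + 2 - ?q ^ Suc j / ?q ^ l" by blast
      have eq: "?q ^ Suc j * (s j + r') = ?q ^ Suc j * (s j + r) + ?q ^ Suc j * (of_int d / ?q ^ Suc l)"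
        by (simp add: r'_def algebra_simps)
      have "0 \<le> ?q ^ Suc j * (of_int d / ?q ^ Suc l)" using d' q by simp
      moreover have "?q ^ Suc j * (of_int d / ?q ^ Suc l) \<le> ?q ^ Suc j * (1 / ?q ^ l - 1 / ?q ^ Suc l)"
        using step q by (intro mult_left_mono) auto
      then have "?q ^ Suc j * (of_int d / ?q ^ Suc l) \<le> ?q ^ Suc j / ?q ^ l - ?q ^ Suc j / ?q ^ Suc l"
        by (simp add: right_diff_distrib)
      ultimately show ?thesis using z eq by (intro exI[of _ z]) linarith
    qed
    ultimately show ?case by blast
  qed
  then obtain r where r: "1 \<le> r" "r \<le> 2 - 1 / ?q ^ l"
    and R: "\<And>j. j < l \<Longrightarrow> \<exists>z::int. ?q * of_int z \<le> ?q ^ Suc j * (s j + r)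
         \<and> ?q ^ Suc j * (s j + r) < ?q * of_int z + 2 - ?q ^ Suc j / ?q ^ l"
    by blast
  have "\<exists>z::int. \<bar>?q ^ j * (s j + r) - of_int z\<bar> < 2 / ?q" if j: "j < l" for j
  proof -
    obtain z :: int where z: "?q * of_int z \<le> ?q ^ Suc j * (s j + r)"
      "?q ^ Suc j * (s j + r) < ?q * of_int z + 2 - ?q ^ Suc j / ?q ^ l" using R[OF j] by blast
    define w where "w = ?q ^ j * (s j + r)"
    have "?q ^ Suc j * (s j + r) = ?q * w" by (simp add: w_def)
    moreover have "0 \<le> ?q ^ Suc j / ?q ^ l" by simp
    ultimately have "?q * of_int z \<le> ?q * w" "?q * w < ?q * of_int z + 2" using z by linarith+
    then have "of_int z \<le> w" "w < of_int z + 2 / ?q" using q by (simp_all add: field_simps)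
    then show ?thesis unfolding w_def[symmetric] by (intro exI[of _ z]) (simp add: abs_less_iff)
  qed
  moreover have "r \<le> 2" using r(2) q by (smt (verit) divide_pos_pos zero_less_power)
  ultimately show ?thesis using r by blast
qed

section \<open>The set of points with vanishing digits and its measure\<close>

lemma sets_digit_zero: "digit_zero q l c \<in> sets borel"
proof -
  have "digit_zero q l c = (\<Union>j\<in>{..<l}. \<Union>z::int. {t. \<bar>real q ^ j * t - of_int z\<bar> < c / real q})"
    by (auto simp: digit_zero_def)
  also have "open \<dots>"
    by (intro open_UN ballI open_Collect_less continuous_intros)
  finally show ?thesis by (rule borel_open)
qed

text \<open>For each \<open>j\<close> the set is covered by intervals of length
  \<open>6 / q ^ Suc j\<close> around the points \<open>z / q ^ j\<close>. Since |t| \<le> 4 and 3 /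
  q \<le> 3, only |z| \<le> 7 q^j occurs, which leaves at most 15 q^j intervals; 15 * 6 =
  90.\<close>

lemma emeasure_digit_zero_le:
  assumes "q \<ge> 1"
  shows "emeasure lborel (digit_zero q l 3 \<inter> {-4..4}) \<le> ennreal (90 * real l / real q)"
proof -
  let ?q = "real q"
  have q: "?q \<ge> 1" using assms by simp
  define T where "T = (SIGMA j:{..<l}. {- (7 * int q ^ j)..7 * int q ^ j})"
  define A :: "nat \<times> int \<Rightarrow> real set" where
    "A = (\<lambda>(j, z). {(of_int z - 3 / ?q) / ?q ^ j<..<(of_int z + 3 / ?q) / ?q ^ j})"
  have finT: "finite T" by (simp add: T_def)
  have "digit_zero q l 3 \<inter> {-4..4} \<subseteq> (\<Union>a\<in>T. A a)"
  proof
    fix t assume "t \<in> digit_zero q l 3 \<inter> {-4..4}"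
    then obtain j z where j: "j < l" and z: "\<bar>?q ^ j * t - of_int z\<bar> < 3 / ?q" and t: "\<bar>t\<bar> \<le> 4"
      by (auto simp: digit_zero_def)
    have qj: "?q ^ j \<ge> 1" using q by simp
    have "\<bar>?q ^ j * t\<bar> \<le> ?q ^ j * 4" using t qj by (simp add: abs_mult mult_left_mono)
    moreover have "3 / ?q \<le> 3" using q by (simp add: field_simps)
    ultimately have "\<bar>real_of_int z\<bar> \<le> 7 * ?q ^ j" using z qj by (simp add: abs_le_iff abs_less_iff)
    then have "real_of_int \<bar>z\<bar> \<le> real_of_int (7 * int q ^ j)" by simp
    then have "\<bar>z\<bar> \<le> 7 * int q ^ j" by (simp only: of_int_le_iff)
    then have "(j, z) \<in> T" using j by (auto simp: T_def)
    have "of_int z - 3 / ?q < t * ?q ^ j" "t * ?q ^ j < of_int z + 3 / ?q"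
      using z by (simp_all add: abs_less_iff mult.commute)
    moreover have "?q ^ j > 0" using q by simp
    ultimately have "t \<in> A (j, z)"
      by (simp add: A_def pos_divide_less_eq pos_less_divide_eq)
    with \<open>(j, z) \<in> T\<close> show "t \<in> (\<Union>a\<in>T. A a)" by blast
  qed
  then have "emeasure lborel (digit_zero q l 3 \<inter> {-4..4}) \<le> emeasure lborel (\<Union>a\<in>T. A a)"
    by (rule emeasure_mono) (use finT in \<open>auto simp: A_def intro!: sets.finite_UN\<close>)
  also have "\<dots> \<le> (\<Sum>a\<in>T. emeasure lborel (A a))"
    by (rule emeasure_subadditive_finite[OF finT]) (auto simp: A_def)
  also have "\<dots> = (\<Sum>(j, z)\<in>T. ennreal (6 / ?q / ?q ^ j))"
  proof (rule sum.cong[OF refl], clarify)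
    fix j :: nat and z :: int
    have qj: "?q ^ j > 0" using q by simp
    have "(of_int z + 3 / ?q) / ?q ^ j - (of_int z - 3 / ?q) / ?q ^ j = 6 / ?q / ?q ^ j"
      using q qj by (simp add: field_simps)
    moreover from this have "(of_int z - 3 / ?q) / ?q ^ j \<le> (of_int z + 3 / ?q) / ?q ^ j"
      using divide_nonneg_pos[OF divide_nonneg_pos[of 6 ?q] qj] q by linarith
    ultimately show "emeasure lborel (A (j, z)) = ennreal (6 / ?q / ?q ^ j)"
      unfolding A_def prod.case by (simp only: emeasure_lborel_Ioo)
  qed
  also have "\<dots> = ennreal (\<Sum>(j, z)\<in>T. 6 / ?q / ?q ^ j)"
    by (subst sum_ennreal[symmetric]) (auto simp: split_def)
  also have "(\<Sum>(j, z)\<in>T. 6 / ?q / ?q ^ j) = (\<Sum>j<l. (14 * ?q ^ j + 1) * (6 / ?q / ?q ^ j))"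
  proof -
    have "(\<Sum>(j, z)\<in>T. 6 / ?q / ?q ^ j)
      = (\<Sum>j<l. \<Sum>z\<in>{- (7 * int q ^ j)..7 * int q ^ j}. 6 / ?q / ?q ^ j)"
      unfolding T_def by (rule sum.Sigma[symmetric]) auto
    also have "\<dots> = (\<Sum>j<l. (14 * ?q ^ j + 1) * (6 / ?q / ?q ^ j))"
    proof (rule sum.cong[OF refl])
      fix j :: nat
      have "real (card {- (7 * int q ^ j)..7 * int q ^ j}) = real_of_int (14 * int q ^ j + 1)"
        by simp
      then show "(\<Sum>z\<in>{- (7 * int q ^ j)..7 * int q ^ j}. 6 / ?q / ?q ^ j) = (14 * ?q ^ j + 1) * (6 / ?q / ?q ^ j)"
        by (simp only: sum_constant of_int_add of_int_mult of_int_power of_int_of_nat_eq of_int_numeral of_int_1)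
    qed
    finally show ?thesis .
  qed
  also have "\<dots> \<le> (\<Sum>j<l. 90 / ?q)"
  proof (rule sum_mono)
    fix j :: nat
    have qj: "?q ^ j \<ge> 1" using q by simp
    have "(14 * ?q ^ j + 1) * (6 / ?q / ?q ^ j) \<le> (15 * ?q ^ j) * (6 / ?q / ?q ^ j)"
      using q qj by (intro mult_right_mono) auto
    also have "\<dots> = 90 / ?q" using q by simp
    finally show "(14 * ?q ^ j + 1) * (6 / ?q / ?q ^ j) \<le> 90 / ?q" .
  qed
  also have "\<dots> = 90 * real l / ?q" by simp
  finally show ?thesis by (simp add: ennreal_leI)
qed


lemma prod_mono_ennreal:
  fixes f g :: "'a \<Rightarrow> ennreal"
  assumes "\<And>i. i \<in> A \<Longrightarrow> f i \<le> g i"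
  shows "prod f A \<le> prod g A"
  using assms by (induction A rule: infinite_finite_induct) (auto intro: mult_mono)

text \<open>The side of the cube fits centres in the unit cube: |x_i| + r + \<delta> < 1 + 2 + 1.
  Writing the set as a union over \<open>J\<close> makes it a finite union of boxes.\<close>

definition digit_zero_set :: "nat \<Rightarrow> nat \<Rightarrow> nat \<Rightarrow> (real^'n::finite) set" where
  "digit_zero_set m q l = (\<Union>J\<in>{J. card J = m}.
     {y. \<forall>i. y $ i \<in> (if i \<in> J then digit_zero q l 3 \<inter> {-4..4} else {-4..4})})"

lemma sets_digit_zero_set: "digit_zero_set m q l \<in> sets borel"
  unfolding digit_zero_set_def
  by (intro sets.finite_UN sets_lborel_vec_box) (auto intro!: sets.Int sets_digit_zero)

lemma emeasure_digit_zero_set_le: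
  assumes "q \<ge> 1"
  shows "emeasure lebesgue (digit_zero_set m q l :: (real^'n::finite) set)
    \<le> ennreal (2 ^ CARD('n) * (8 ^ CARD('n) * (90 * real l / real q) ^ m))"
proof -
  let ?b = "90 * real l / real q"
  let ?B = "\<lambda>J i. if i \<in> J then digit_zero q l 3 \<inter> {-4..4} else {-4..4::real}"
  have B: "?B J i \<in> sets borel" for J :: "'n set" and i
    by (auto intro!: sets.Int sets_digit_zero)
  have "emeasure lebesgue (digit_zero_set m q l :: (real^'n) set)
      = emeasure lborel (digit_zero_set m q l :: (real^'n) set)"
    by (simp add: sets_digit_zero_set)
  also have "\<dots> \<le> (\<Sum>J\<in>{J. card J = m}. emeasure lborel {y::real^'n. \<forall>i. y $ i \<in> ?B J i})"
    unfolding digit_zero_set_def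
  proof (rule emeasure_subadditive_finite)
    show "(\<lambda>J. {y::real^'n. \<forall>i. y $ i \<in> ?B J i}) ` {J. card J = m} \<subseteq> sets lborel"
      unfolding sets_lborel by (intro image_subsetI sets_lborel_vec_box B)
  qed simp
  also have "\<dots> \<le> (\<Sum>J\<in>{J::'n set. card J = m}. ennreal (8 ^ CARD('n) * ?b ^ m))"
  proof (rule sum_mono)
    fix J :: "'n set" assume "J \<in> {J. card J = m}"
    then have J: "card J = m" by simp
    have "emeasure lborel {y::real^'n. \<forall>i. y $ i \<in> ?B J i} = (\<Prod>i\<in>UNIV. emeasure lborel (?B J i))"
      by (rule emeasure_lborel_vec_box[OF B])
    \<comment> \<open>The factor 8, the length of \<open>{-4..4}\<close>, is spent on the
      coordinates in \<open>J\<close> as well, which gives \<open>8 ^ n\<close> whatever m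
      is.\<close>
    also have "\<dots> \<le> (\<Prod>i\<in>UNIV. ennreal (8 * (if i \<in> J then ?b else 1)))"
    proof (rule prod_mono_ennreal)
      fix i :: 'n
      have "emeasure lborel (digit_zero q l 3 \<inter> {-4..4}) \<le> ennreal (8 * ?b)"
        using emeasure_digit_zero_le[OF assms, of l] by (rule order_trans) (simp add: ennreal_leI divide_right_mono)
      then show "emeasure lborel (?B J i) \<le> ennreal (8 * (if i \<in> J then ?b else 1))"
        by auto
    qed
    also have "\<dots> = ennreal (\<Prod>i\<in>UNIV. 8 * (if i \<in> J then ?b else 1))"
      by (rule prod_ennreal) auto
    also have "(\<Prod>i\<in>UNIV. 8 * (if i \<in> J then ?b else 1)) = 8 ^ CARD('n) * ?b ^ m"
      using J by (simp add: prod.distrib prod.If_cases)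
    finally show "emeasure lborel {y::real^'n. \<forall>i. y $ i \<in> ?B J i} \<le> ennreal (8 ^ CARD('n) * ?b ^ m)" .
  qed
  also have "\<dots> = of_nat (card {J::'n set. card J = m}) * ennreal (8 ^ CARD('n) * ?b ^ m)" by simp
  also have "\<dots> \<le> of_nat (2 ^ CARD('n)) * ennreal (8 ^ CARD('n) * ?b ^ m)"
  proof (intro mult_right_mono of_nat_mono)
    have "card {J::'n set. card J = m} \<le> card (Pow (UNIV :: 'n set))"
      by (intro card_mono) auto
    then show "card {J::'n set. card J = m} \<le> 2 ^ CARD('n)" by (simp add: card_Pow)
  qed simp
  also have "\<dots> = ennreal (2 ^ CARD('n) * (8 ^ CARD('n) * ?b ^ m))"
    by (simp add: ennreal_mult flip: ennreal_of_nat_eq_real_of_nat ennreal_power)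
  finally show ?thesis .
qed

section \<open>Skeletons inside this set and the test function\<close>

text \<open>By symmetry under sign change, a vanishing digit of x_i - r is one of - x_i + r. All 2n
  numbers thus have the form \<open>s j + r\<close> with a common \<open>r\<close>, and the
  bijection \<open>h\<close> assigns to each of them its own place.\<close>

lemma inf_nbhd_cube_face_subset_digit_zero_set:
  fixes x :: "real^'n::finite"
  assumes x: "\<And>i. x $ i \<in> {0..1}" and q: "q \<ge> 1" and \<delta>: "0 < \<delta>" "\<delta> < 1"
    and q\<delta>: "real q ^ (2 * CARD('n)) * \<delta> \<le> 1" and "k \<le> CARD('n)"
  shows "\<exists>r\<in>{1..2}. \<forall>F\<in>k_faces k x r. inf_nbhd \<delta> F \<subseteq> digit_zero_set (CARD('n) - k) q (2 * CARD('n))"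
proof -
  let ?l = "2 * CARD('n)" and ?q = "real q"
  obtain h where h: "bij_betw h {0..<?l} (UNIV :: ('n \<times> bool) set)"
    using ex_bij_betw_nat_finite[of "UNIV :: ('n \<times> bool) set"] by (auto simp: card_cartesian_product mult.commute)
  define s where "s j = (case h j of (i, b) \<Rightarrow> if b then x $ i else - x $ i)" for j
  obtain r where r: "1 \<le> r" "r \<le> 2"
    and dig: "\<And>j. j < ?l \<Longrightarrow> \<exists>z::int. \<bar>?q ^ j * (s j + r) - of_int z\<bar> < 2 / ?q"
    using exists_common_radius[OF q, of ?l s] by blast
  have digit: "t \<in> digit_zero q ?l 3" if t: "\<bar>t - (x $ i + (if b then r else - r))\<bar> < \<delta>" for t i b
  proof -
    obtain j where j: "j < ?l" "h j = (i, b)"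
      using h unfolding bij_betw_def by (metis UNIV_I atLeastLessThan_iff imageE)
    from dig[OF j(1)] obtain z :: int where z: "\<bar>?q ^ j * (s j + r) - of_int z\<bar> < 2 / ?q" by blast
    define z' where "z' = (if b then z else - z)"
    have s: "s j + r = (if b then 1 else -1) * (x $ i + (if b then r else - r))"
      by (simp add: s_def j)
    have z': "\<bar>?q ^ j * (x $ i + (if b then r else - r)) - of_int z'\<bar> < 2 / ?q"
    proof (cases b)
      case True
      then show ?thesis using z by (simp add: s z'_def)
    next
      case False
      have sj: "s j + r = - (x $ i + (if b then r else - r))" using s False by simp
      have "?q ^ j * (x $ i + (if b then r else - r)) - of_int z' = - (?q ^ j * (s j + r) - of_int z)"
        unfolding sj using False by (simp add: z'_def algebra_simps)
      then show ?thesis using z by (simp only: abs_minus_cancel)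
    qed
    \<comment> \<open>At each of the places in use a shift by \<open>\<delta>\<close> costs at most
      one more unit, so the tolerance 2 of the exact coordinate becomes 3.\<close>
    have "?q ^ Suc j \<le> ?q ^ ?l" using q j by (intro power_increasing) auto
    then have "?q ^ Suc j * \<delta> \<le> ?q ^ ?l * \<delta>" using \<delta> by (intro mult_right_mono) auto
    then have "?q ^ Suc j * \<delta> \<le> 1" using q\<delta> by linarith
    then have "?q ^ j * \<delta> \<le> 1 / ?q" using q by (simp add: field_simps)
    moreover have "\<bar>?q ^ j * (t - (x $ i + (if b then r else - r)))\<bar> \<le> ?q ^ j * \<delta>"
      using t by (simp add: abs_mult mult_left_mono)
    ultimately have "\<bar>?q ^ j * t - of_int z'\<bar> < 2 / ?q + 1 / ?q"
      using z' by (simp add: right_diff_distrib abs_less_iff abs_le_iff)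
    also have "\<dots> = 3 / ?q" by (simp add: add_divide_distrib[symmetric])
    finally show ?thesis unfolding digit_zero_def using j by blast
  qed
  have "inf_nbhd \<delta> (cube_face x r I P) \<subseteq> digit_zero_set (CARD('n) - k) q ?l"
    if I: "card I = k" for I P
  proof
    fix y assume "y \<in> inf_nbhd \<delta> (cube_face x r I P)"
    then have y: "y $ i \<in> (if i \<in> I then {x $ i - (r + \<delta>)<..<x $ i + (r + \<delta>)}
      else {x $ i + (if i \<in> P then r else - r) - \<delta><..<x $ i + (if i \<in> P then r else - r) + \<delta>})" for i
      using inf_nbhd_cube_face[of r \<delta> x I P] r \<delta> by auto
    have "card (- I) = CARD('n) - k" using I by (simp add: Compl_eq_Diff_UNIV card_Diff_subset)
    moreover have "y $ i \<in> {-4..4}" for i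
      using y[of i] x[of i] r \<delta> by (auto split: if_splits)
    moreover have "y $ i \<in> digit_zero q ?l 3" if "i \<in> - I" for i
      using y[of i] that by (intro digit[of _ i "i \<in> P"]) (auto simp: abs_less_iff)
    ultimately show "y \<in> digit_zero_set (CARD('n) - k) q ?l"
      unfolding digit_zero_set_def by auto
  qed
  then have "\<forall>F\<in>k_faces k x r. inf_nbhd \<delta> F \<subseteq> digit_zero_set (CARD('n) - k) q ?l"
    by (auto simp: k_faces_def)
  then show ?thesis using r by (intro bexI[of _ r]) simp_all
qed

lemma abs_average_indicator_cube_face:
  fixes x :: "real^'n"
  assumes "r \<ge> 0" "\<delta> > 0" and sub: "inf_nbhd \<delta> (cube_face x r I P) \<subseteq> E"
  shows "abs_average (inf_nbhd \<delta> (cube_face x r I P)) (indicator E) = 1"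
proof -
  let ?S = "inf_nbhd \<delta> (cube_face x r I P)"
  have S: "?S \<in> sets borel" by (rule sets_inf_nbhd_cube_face[OF assms(1,2)])
  have "(\<integral>\<^sup>+y\<in>?S. ennreal \<bar>indicator E y\<bar> \<partial>lebesgue) = (\<integral>\<^sup>+y. indicator ?S y \<partial>lebesgue)"
    using sub by (intro nn_integral_cong) (auto simp: indicator_def)
  also have "\<dots> = emeasure lebesgue ?S" using S by simp
  finally have I: "(\<integral>\<^sup>+y\<in>?S. ennreal \<bar>indicator E y\<bar> \<partial>lebesgue) = emeasure lebesgue ?S" .
  have m: "emeasure lebesgue ?S = ennreal ((2 * (r + \<delta>)) ^ card I * (2 * \<delta>) ^ card (- I))"
    by (rule emeasure_inf_nbhd_cube_face[OF assms(1,2)])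
  have "(2 * (r + \<delta>)) ^ card I * (2 * \<delta>) ^ card (- I) > 0" using assms by simp
  then show ?thesis unfolding abs_average_def I unfolding m
    by (intro ennreal_divide_self) (auto simp: ennreal_eq_0_iff)
qed

text \<open>The test function is the indicator of \<open>E\<close>: for every centre in the unit
  cube some radius puts all face neighbourhoods inside \<open>E\<close>, so the maximal function is
  at least 1 there, whereas the norm of the indicator is the p-th root of the measure of
  \<open>E\<close>, at most \<open>b\<close>.\<close>

lemma Lp_opnorm_skeleton_maximal_ge:
  fixes k :: nat
  assumes k: "k < CARD('n::finite)" and "p \<ge> 1" and \<delta>: "0 < \<delta>" "\<delta> < 1"
    and q: "q \<ge> 1" "real q ^ (2 * CARD('n)) * \<delta> \<le> 1"
    and b: "b = 2 ^ CARD('n) * (8 ^ CARD('n) * (180 * real CARD('n) / real q) ^ (CARD('n) - k))"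
  shows "ennreal (b powr (- 1 / p))
    \<le> Lp_opnorm p (skeleton_maximal k \<delta> :: (real^'n \<Rightarrow> real) \<Rightarrow> real^'n \<Rightarrow> ennreal)"
proof -
  let ?l = "2 * CARD('n)"
  define E :: "(real^'n) set" where "E = digit_zero_set (CARD('n) - k) q ?l"
  have p: "p > 0" using \<open>p \<ge> 1\<close> by simp
  have E: "E \<in> sets borel" unfolding E_def by (rule sets_digit_zero_set)
  have Eb: "emeasure lebesgue E \<le> ennreal b"
    using emeasure_digit_zero_set_le[OF q(1), of "CARD('n) - k" ?l] by (simp add: E_def b)
  define f :: "real^'n \<Rightarrow> real" where "f = indicator E"
  have M: "1 \<le> skeleton_maximal k \<delta> f x" if x: "\<And>i. x $ i \<in> {0..1}" for x
  proof -
    obtain r where r: "r \<in> {1..2}" and sub: "\<And>F. F \<in> k_faces k x r \<Longrightarrow> inf_nbhd \<delta> F \<subseteq> E"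
      using inf_nbhd_cube_face_subset_digit_zero_set[OF x q(1) \<delta> q(2), of k] k
      unfolding E_def by auto
    have "1 \<le> Min ((\<lambda>F. abs_average (inf_nbhd \<delta> F) f) ` k_faces k x r)"
    proof (rule Min.boundedI)
      show "finite ((\<lambda>F. abs_average (inf_nbhd \<delta> F) f) ` k_faces k x r)"
        by (intro finite_imageI finite_k_faces)
      show "(\<lambda>F. abs_average (inf_nbhd \<delta> F) f) ` k_faces k x r \<noteq> {}"
        using k_faces_nonempty[of k x r] k by simp
      fix a assume "a \<in> (\<lambda>F. abs_average (inf_nbhd \<delta> F) f) ` k_faces k x r"
      then obtain F where F: "F \<in> k_faces k x r" "a = abs_average (inf_nbhd \<delta> F) f" by blast
      then obtain I P where IP: "F = cube_face x r I P" by (auto simp: k_faces_def)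
      show "1 \<le> a"
        using abs_average_indicator_cube_face[of r \<delta> x I P E] sub[OF F(1)] r \<delta>
        by (simp add: F IP f_def)
    qed
    also have "\<dots> \<le> skeleton_maximal k \<delta> f x"
      unfolding skeleton_maximal_def by (rule SUP_upper[OF r])
    finally show ?thesis .
  qed
  define Q :: "(real^'n) set" where "Q = {x. \<forall>i. x $ i \<in> {0..1}}"
  have Q: "Q \<in> sets borel" "emeasure lebesgue Q = 1"
    using sets_lborel_vec_box[of "\<lambda>_::'n. {0..1::real}"]
      emeasure_lborel_vec_box[of "\<lambda>_::'n. {0..1::real}"] by (simp_all add: Q_def)
  have "1 = emeasure lebesgue Q" using Q by simp
  also have "\<dots> = (\<integral>\<^sup>+x. indicator Q x \<partial>lebesgue)" using Q by simp
  also have "\<dots> \<le> (\<integral>\<^sup>+x. ennreal_powr (skeleton_maximal k \<delta> f x) p \<partial>lebesgue)"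
  proof (rule nn_integral_mono)
    fix x
    have "ennreal_powr 1 p \<le> ennreal_powr (skeleton_maximal k \<delta> f x) p" if "x \<in> Q"
      using M[of x] that p by (intro ennreal_powr_mono) (auto simp: Q_def)
    moreover have "ennreal_powr 1 p = 1" using ennreal_powr_ennreal[of 1 p] by simp
    ultimately show "indicator Q x \<le> ennreal_powr (skeleton_maximal k \<delta> f x) p"
      by (auto simp: indicator_def)
  qed
  finally have "ennreal_powr 1 (1 / p) \<le> Lp_norm p (skeleton_maximal k \<delta> f)"
    unfolding Lp_norm_def using p by (intro ennreal_powr_mono) auto
  then have num: "1 \<le> Lp_norm p (skeleton_maximal k \<delta> f)"
    using ennreal_powr_ennreal[of 1 "1 / p"] by simp
  have "(\<integral>\<^sup>+x. ennreal_powr (ennreal \<bar>f x\<bar>) p \<partial>lebesgue) = emeasure lebesgue E"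
    using E unfolding f_def ennreal_powr_indicator[OF p] by simp
  then have den: "Lp_norm_real p f = ennreal_powr (emeasure lebesgue E) (1 / p)"
    by (simp add: Lp_norm_def)
  obtain e where e: "emeasure lebesgue E = ennreal e" "0 \<le> e" "e \<le> b"
    using Eb by (cases "emeasure lebesgue E" rule: ennreal_cases) (auto simp: top_unique b ennreal_le_iff)
  \<comment> \<open>Positive measure makes the indicator an admissible test function;
    \<open>E\<close> contains the neighbourhood of a face centred at 0, a point of the unit
    cube.\<close>
  have "e > 0"
  proof -
    obtain r where r: "r \<in> {1..2}" and sub: "\<And>F. F \<in> k_faces k (0::real^'n) r \<Longrightarrow> inf_nbhd \<delta> F \<subseteq> E"
      using inf_nbhd_cube_face_subset_digit_zero_set[OF _ q(1) \<delta> q(2), of 0 k] k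
      unfolding E_def by auto
    obtain I P where IP: "cube_face (0::real^'n) r I P \<in> k_faces k 0 r"
      using k_faces_nonempty[of k "0::real^'n" r] k by (auto simp: k_faces_def)
    have "emeasure lebesgue (inf_nbhd \<delta> (cube_face (0::real^'n) r I P)) \<le> emeasure lebesgue E"
      using sub[OF IP] E by (intro emeasure_mono) auto
    moreover have "0 < (2 * (r + \<delta>)) ^ card I * (2 * \<delta>) ^ card (- I)" using r \<delta> by simp
    then have "0 < emeasure lebesgue (inf_nbhd \<delta> (cube_face (0::real^'n) r I P))"
      using r \<delta> by (simp add: emeasure_inf_nbhd_cube_face del: emeasure_completion)
    ultimately show ?thesis using e by (metis ennreal_less_zero_iff order_less_le_trans)
  qed
  have "\<not> (AE x in lebesgue. f x = 0)"
  proof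
    assume "AE x in lebesgue. f x = 0"
    then have "AE x in lebesgue. x \<notin> E" by (rule AE_mp) (auto simp: f_def indicator_def)
    then have "emeasure lebesgue E = 0"
      using E by (subst (asm) AE_iff_measurable[of E]) auto
    then show False using e \<open>e > 0\<close> by simp
  qed
  moreover have "f \<in> Lp_space p"
    unfolding Lp_space_def using den e E by (auto simp: f_def intro!: borel_measurable_indicator)
  ultimately have "Lp_norm p (skeleton_maximal k \<delta> f) / Lp_norm_real p f
      \<le> Lp_opnorm p (skeleton_maximal k \<delta> :: (real^'n \<Rightarrow> real) \<Rightarrow> real^'n \<Rightarrow> ennreal)"
    unfolding Lp_opnorm_def
    by (intro SUP_upper2[where i = f]) simp_all
  moreover have "1 / Lp_norm_real p f \<le> Lp_norm p (skeleton_maximal k \<delta> f) / Lp_norm_real p f"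
    using num by (rule divide_right_mono_ennreal)
  moreover have "1 / Lp_norm_real p f = ennreal (1 / e powr (1 / p))"
    using e \<open>e > 0\<close> divide_ennreal[of 1 "e powr (1 / p)"] by (simp add: den)
  moreover have "b powr (- 1 / p) \<le> 1 / e powr (1 / p)"
  proof -
    have "b powr (- 1 / p) \<le> e powr (- 1 / p)"
      using e \<open>e > 0\<close> p by (intro powr_mono2') auto
    then show ?thesis by (simp add: powr_minus_divide)
  qed
  ultimately show ?thesis by (metis ennreal_leI order_trans)
qed

lemma exists_lower_constant:
  fixes k :: nat
  assumes k: "k < CARD('n::finite)"
  shows "\<exists>C>0. \<forall>p\<ge>1. \<forall>\<delta>. 0 < \<delta> \<and> \<delta> < 1 \<longrightarrow>
    ennreal (C * \<delta> powr ((real k - real CARD('n)) / (2 * real CARD('n) * p)))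
      \<le> Lp_opnorm p (skeleton_maximal k \<delta> :: (real^'n \<Rightarrow> real) \<Rightarrow> real^'n \<Rightarrow> ennreal)"
proof -
  let ?n = "real CARD('n)" and ?l = "2 * CARD('n)"
  define m where "m = CARD('n) - k"
  \<comment> \<open>360 = 2 * 180, where 180 n = 90 * 2n comes from the 2n digits and the 2 pays for
    rounding the base down to an integer.\<close>
  define L where "L = 2 ^ CARD('n) * (8 ^ CARD('n) * (360 * ?n) ^ m)"
  have n1: "?n \<ge> 1" using zero_less_card_finite[where 'a = 'n] by linarith
  have "1 \<le> (360 * ?n) ^ m" using n1 by (intro one_le_power) linarith
  then have "(1::real) * (1 * 1) \<le> L" unfolding L_def by (intro mult_mono) auto
  then have L: "L \<ge> 1" by simp
  have "ennreal (1 / L * \<delta> powr ((real k - ?n) / (2 * ?n * p)))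
      \<le> Lp_opnorm p (skeleton_maximal k \<delta> :: (real^'n \<Rightarrow> real) \<Rightarrow> real^'n \<Rightarrow> ennreal)"
    if p: "p \<ge> 1" and \<delta>: "0 < \<delta>" "\<delta> < 1" for p \<delta>
  proof -
    define u where "u = \<delta> powr (- 1 / (2 * ?n))"
    \<comment> \<open>The largest integer base with q^(2n) \<le> 1 / \<delta>; as
      \<open>u \<ge> 1\<close>, rounding down loses at most a factor 2.\<close>
    define q where "q = nat \<lfloor>u\<rfloor>"
    have u1: "u \<ge> 1"
    proof -
      have "\<delta> powr 0 \<le> u" unfolding u_def using \<delta> n1 by (intro powr_mono') auto
      then show ?thesis using \<delta> by simp
    qed
    then have qu: "real q \<le> u" "u < real q + 1" "q \<ge> 1"
      by (simp_all add: q_def nat_le_iff le_nat_iff le_floor_iff) 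
    have "u ^ ?l = 1 / \<delta>"
    proof -
      have "u ^ ?l = \<delta> powr (- 1 / (2 * ?n) * real ?l)"
        using \<delta> by (simp add: u_def powr_powr flip: powr_realpow)
      also have "- 1 / (2 * ?n) * real ?l = - 1" using n1 by simp
      finally show ?thesis using \<delta> by (simp add: powr_minus_divide)
    qed
    moreover have "real q ^ ?l \<le> u ^ ?l" using qu by (intro power_mono) auto
    ultimately have "real q ^ ?l * \<delta> \<le> 1 / \<delta> * \<delta>"
      using \<delta> by (intro mult_right_mono) auto
    then have q\<delta>: "real q ^ ?l * \<delta> \<le> 1" using \<delta> by simp
    define b where "b = 2 ^ CARD('n) * (8 ^ CARD('n) * (180 * ?n / real q) ^ m)"
    have b0: "b > 0" using n1 qu by (simp add: b_def)
    have "real q \<ge> 1" using qu(3) by simp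
    then have "u \<le> 2 * real q" using qu(2) by linarith
    then have "180 * ?n / real q \<le> 360 * ?n / u"
      using qu(3) u1 n1 by (simp add: field_simps)
    then have "(180 * ?n / real q) ^ m \<le> (360 * ?n / u) ^ m"
      using qu n1 by (intro power_mono) auto
    then have "b \<le> 2 ^ CARD('n) * (8 ^ CARD('n) * (360 * ?n / u) ^ m)"
      unfolding b_def by (intro mult_left_mono) auto
    also have "\<dots> = L * (1 / u ^ m)" by (simp add: L_def power_divide)
    finally have bL: "b \<le> L * (1 / u ^ m)" .
    \<comment> \<open>Since \<open>L \<ge> 1\<close> and \<open>p \<ge> 1\<close>, the constant
      \<open>1 / L\<close> works for all p at once.\<close>
    have "L powr (- 1) \<le> L powr (- 1 / p)"
      using L p by (intro powr_mono) (auto simp: field_simps)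
    then have "1 / L \<le> L powr (- 1 / p)" using L by (simp add: powr_minus_divide)
    moreover have "(1 / u ^ m) powr (- 1 / p) = \<delta> powr ((real k - ?n) / (2 * ?n * p))"
    proof -
      have "1 / u ^ m = u powr (- real m)"
        using u1 by (simp add: powr_minus_divide powr_realpow)
      then have "(1 / u ^ m) powr (- 1 / p) = \<delta> powr (- 1 / (2 * ?n) * (- real m) * (- 1 / p))"
        by (simp only: u_def powr_powr)
      also have "- 1 / (2 * ?n) * (- real m) * (- 1 / p) = (real k - ?n) / (2 * ?n * p)"
        using k n1 p by (simp add: m_def field_simps of_nat_diff)
      finally show ?thesis .
    qed
    ultimately have "1 / L * \<delta> powr ((real k - ?n) / (2 * ?n * p))
        \<le> L powr (- 1 / p) * (1 / u ^ m) powr (- 1 / p)"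
      by (intro mult_mono) auto
    also have "\<dots> = (L * (1 / u ^ m)) powr (- 1 / p)"
      by (rule powr_mult[symmetric])
    also have "\<dots> \<le> b powr (- 1 / p)"
      using bL b0 p by (intro powr_mono2') auto
    finally have "ennreal (1 / L * \<delta> powr ((real k - ?n) / (2 * ?n * p))) \<le> ennreal (b powr (- 1 / p))"
      by (rule ennreal_leI)
    also have "\<dots> \<le> Lp_opnorm p (skeleton_maximal k \<delta> :: (real^'n \<Rightarrow> real) \<Rightarrow> real^'n \<Rightarrow> ennreal)"
      by (rule Lp_opnorm_skeleton_maximal_ge[OF k p \<delta> qu(3) q\<delta> b_def[unfolded m_def]])
    finally show ?thesis .
  qed
  moreover have "1 / L > 0" using L by simp
  ultimately show ?thesis by blast
qed

section \<open>The norm of the maximal operator\<close>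

theorem theorem1p2:
  fixes k :: nat
  assumes "k < CARD('n::finite)"
  shows "\<exists>C::real. C > 0 \<and> (\<forall>\<epsilon>::real. \<epsilon> > 0 \<longrightarrow> (\<exists>C'::real. C' > 0 \<and>
    (\<forall>p::real. p \<ge> 1 \<longrightarrow> (\<forall>\<delta>::real. 0 < \<delta> \<and> \<delta> < 1 \<longrightarrow>
      ennreal (C' * \<delta> powr ((real k - real CARD('n)) / (2 * real CARD('n) * p) + \<epsilon>))
        \<le> Lp_opnorm p (skeleton_maximal k \<delta> :: (real^'n \<Rightarrow> real) \<Rightarrow> real^'n \<Rightarrow> ennreal)
      \<and> Lp_opnorm p (skeleton_maximal k \<delta> :: (real^'n \<Rightarrow> real) \<Rightarrow> real^'n \<Rightarrow> ennreal)
        \<le> ennreal (C * \<delta> powr ((real k - real CARD('n)) / (2 * real CARD('n) * p)))))))"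
proof -
  let ?n = "real CARD('n)"
  let ?M = "\<lambda>\<delta>. skeleton_maximal k \<delta> :: (real^'n \<Rightarrow> real) \<Rightarrow> real^'n \<Rightarrow> ennreal"
  obtain c where c: "c > 0" and lower: "\<And>p \<delta>. 1 \<le> p \<Longrightarrow> 0 < \<delta> \<and> \<delta> < 1 \<Longrightarrow>
      ennreal (c * \<delta> powr ((real k - ?n) / (2 * ?n * p))) \<le> Lp_opnorm p (?M \<delta>)"
    using exists_lower_constant[OF assms] by blast
  have n: "?n > 0" by simp
  define C where "C = 4 * (196 * ?n) ^ CARD('n)"
  have "C > 0" using n unfolding C_def by (intro mult_pos_pos zero_less_power) simp_all
  have "ennreal (c * \<delta> powr ((real k - ?n) / (2 * ?n * p) + \<epsilon>)) \<le> Lp_opnorm p (?M \<delta>)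
      \<and> Lp_opnorm p (?M \<delta>) \<le> ennreal (C * \<delta> powr ((real k - ?n) / (2 * ?n * p)))"
    if "\<epsilon> > 0" "p \<ge> 1" "0 < \<delta> \<and> \<delta> < 1" for \<epsilon> p \<delta>
  proof
    \<comment> \<open>Because \<delta> < 1, raising the exponent by \<epsilon> lowers the
      power.\<close>
    have "\<delta> powr ((real k - ?n) / (2 * ?n * p) + \<epsilon>) \<le> \<delta> powr ((real k - ?n) / (2 * ?n * p))"
      using that by (intro powr_mono') auto
    then have "ennreal (c * \<delta> powr ((real k - ?n) / (2 * ?n * p) + \<epsilon>))
        \<le> ennreal (c * \<delta> powr ((real k - ?n) / (2 * ?n * p)))"
      using c by (intro ennreal_leI mult_left_mono) auto
    also have "\<dots> \<le> Lp_opnorm p (?M \<delta>)" using lower that by blast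
    finally show "ennreal (c * \<delta> powr ((real k - ?n) / (2 * ?n * p) + \<epsilon>)) \<le> Lp_opnorm p (?M \<delta>)" .
    show "Lp_opnorm p (?M \<delta>) \<le> ennreal (C * \<delta> powr ((real k - ?n) / (2 * ?n * p)))"
      unfolding C_def using that by (intro Lp_opnorm_skeleton_maximal_le assms) auto
  qed
  then show ?thesis using c \<open>C > 0\<close> by blast
qed

end
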